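(* Let $d\in\mathbb N$, $\mathcal A:=\{0,1\}$, $\Omega:=\mathcal A^{\mathbb Z^d}$, let $\mathbb P$ be a probability measure on $(\Omega,\mathcal B(\Omega))$ satisfying the properties (M1), (M2), (M3) (listed in the context) with correlation length $r\in\mathbb N_0$, and let $\Lambda_n:=[0,n)^d\cap\mathbb Z^d$ for $n\in\mathbb N$. Let $f\colon\mathcal F\times\Omega\to\mathbb B$, $$f(\Lambda,\omega)(\lambda):=\bigl|\{C_z^\Lambda(\omega)\mid z\in\Lambda,\ |C_z^\Lambda(\omega)|\le\lambda\}\bigr|,\qquad\lambda\in\mathbb R,$$ be the cumulative cluster counting function. There exist a set $\tilde\Omega\subseteq\Omega$ of full measure and a function $f^*\in\mathbb B$ such that, for each $\omega\in\tilde\Omega$, $$\lim_{n\to\infty}\Bigl\lVert\frac{f(\Lambda_n,\omega)}{|\Lambda_n|}-f^*\Bigr\rVert=0 .$$ For all $m,n\in\mathbb N$, $m<n$, we have, for $\omega\in\tilde\Omega$, $$\Bigl\lVert\frac{f(\Lambda_n,\omega)}{|\Lambda_n|}-f^*\Bigr\rVert\le2^{d+1}\Bigl(\frac{8m^d+2}{n-m}+\frac{10r^d+6}{m-r}\Bigr)+\sup_{g\in\mathcal U_{K,D,D',r'}}\frac{\bigl\lVert\langle g_{\Lambda_m^r},L_{m,n}^{r,\omega}-\mathbb P_{\Lambda_m^r}\rangle\bigr\rVert}{|\Lambda_m|},$$ where $K=3$, $D=D'=2$ and $r'=1$.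
   Context: Percolation: for $\omega\in\Omega$, $\Gamma_\omega$ is the graph with vertex set $\mathbb Z^d$ and edge set $\{\{x,y\}:\|x-y\|_1=1,\ \omega_x=\omega_y=1\}$. For $\Lambda\subseteq\mathbb Z^d$, $\Gamma_\omega^\Lambda$ is the induced subgraph on $\Lambda$, and for $x\in\Lambda$, $C_x^\Lambda(\omega)$ is the connected component (cluster) of $x$ in $\Gamma_\omega^\Lambda$ (a vertex with $\omega_x=0$ forms a cluster of size one). $f$ counts clusters, not vertices in clusters. Geometry: $\mathcal F$ is the set of all finite subsets of $\mathbb Z^d$; $|\Lambda|$ is the cardinality of $\Lambda\in\mathcal F$; $\mathfrak d(x,y):=\|x-y\|_1$, $\mathfrak d(\Lambda_1,\Lambda_2):=\min\{\mathfrak d(x,y):x\in\Lambda_1,y\in\Lambda_2\}$, $\mathfrak d(x,\Lambda):=\mathfrak d(\{x\},\Lambda)$; $\Lambda+z:=\{x+z: x\in\Lambda\}$. A cube of side length $n$ is a set $([0,n)^d\cap\mathbb Z^d)+z$, $z\in\mathbb Z^d$. For $r\in\mathbb N_0$, $\partial^r(\Lambda):=\{x\in\Lambda:\mathfrak d(x,\mathbb Z^d\setminus\Lambda)\le r\}\cup\{x\in\mathbb Z^d\setminus\Lambda:\mathfrak d(x,\Lambda)\le r\}$ and $\Lambda^r:=\Lambda\setminus\partial^r(\Lambda)$; $\Lambda_m^r:=(\Lambda_m)^r$. Colorings: $\mathcal B(\Omega)$ is the product $\sigma$-algebra, $\mathcal B(\mathcal A)$ the power set of $\mathcal A$. For $z\in\mathbb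 Z^d$, $\tau_z\colon\Omega\to\Omega$, $(\tau_z\omega)_x:=\omega_{x+z}$. For $\Lambda\in\mathcal F$, $\Omega_\Lambda:=\mathcal A^\Lambda$, $\Pi_\Lambda\colon\Omega\to\Omega_\Lambda$, $\Pi_\Lambda(\omega):=\omega_\Lambda:=(\omega_z)_{z\in\Lambda}$. Assumptions on $\mathbb P$: (M1) $\mathbb P\circ\tau_z^{-1}=\mathbb P$ for all $z\in\mathbb Z^d$. (M2) There are $\sigma$-finite measures $\mu_z$, $z\in\mathbb Z^d$, on $(\mathcal A,\mathcal B(\mathcal A))$ such that for each $\Lambda\in\mathcal F$ the marginal $\mathbb P_\Lambda:=\mathbb P\circ\Pi_\Lambda^{-1}$ is absolutely continuous with respect to $\mu_\Lambda:=\bigotimes_{z\in\Lambda}\mu_z$, with density $\rho_\Lambda:=d\mathbb P_\Lambda/d\mu_\Lambda$. (M3) There is $r\ge0$ (the correlation length) such that for all $n\in\mathbb N$ and non-empty $\Lambda_1,\dots,\Lambda_n\in\mathcal F$ with $\min\{\mathfrak d(\Lambda_i,\Lambda_j): i\ne j\}>r$ one has $\rho_\Lambda=\prod_{j=1}^n\rho_{\Lambda_j}$ ($\mu_\Lambda$-a.e., where $\rho_{\Lambda_j}$ is evaluated at $\omega_{\Lambda_j}$), $\Lambda=\bigcup_j\Lambda_j$. $\mathbb B:=\{F\colon\mathbb R\to\mathbb R\mid F\text{ right-continuous and bounded}\}$ with the supremum norm $\|\cdot\|$. A function $g\colon\mathcal F\times\Omega\to\mathbb B$ is admissible if: (i)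 $g(\Lambda+z,\omega)=g(\Lambda,\tau_z\omega)$ for all $\Lambda\in\mathcal F$, $z\in\mathbb Z^d$, $\omega\in\Omega$; (ii) $g(\Lambda,\omega)=g(\Lambda,\omega')$ whenever $\Lambda\in\mathcal F$ and $\Pi_\Lambda(\omega)=\Pi_\Lambda(\omega')$; (iii) there is $b_g\colon\mathcal F\to[0,\infty)$ such that for all $\omega\in\Omega$ and pairwise disjoint $\Lambda_1,\dots,\Lambda_n\in\mathcal F$ with union $\Lambda$, $\|g(\Lambda,\omega)-\sum_{i=1}^ng(\Lambda_i,\omega)\|\le\sum_{i=1}^nb_g(\Lambda_i)$, where $b_g(\Lambda+z)=b_g(\Lambda)$ for all $\Lambda\in\mathcal F,z\in\mathbb Z^d$; there is $D_g>0$ with $b_g(\Lambda)\le D_g|\Lambda|$ for all $\Lambda\in\mathcal F$; and $b_g(\Lambda_i)/|\Lambda_i|\to0$ for every sequence $(\Lambda_i)$ of cubes with strictly increasing side length; (iv) there is $s\in\{-1,1\}^{\mathbb Z^d}$ such that for all $\Lambda\in\mathcal F$, $\omega,\omega'\in\Omega$, $z\in\Lambda$, $E\in\mathbb R$ with $\omega_{\Lambda\setminus\{z\}}=\omega'_{\Lambda\setminus\{z\}}$ and $\omega_z\le\omega'_z$: $g(\Lambda,\omega)(E)\le g(\Lambda,\omega')(E)$ if $s(z)=1$, and $g(\Lambda,\omega)(E)\ge g(\Lambda,\omega')(E)$ if $s(z)=-1$; (v) $\sup_{\omega\in\Omega}\|g(\{0\},\omega)\|<\infty$. For admissible $g$,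 $K_g:=\sup\{\|g(\Lambda,\omega)\|/|\Lambda| : \omega\in\Omega,\ \Lambda\in\mathcal F\setminus\{\emptyset\}\}<\infty$. The function $b_g$ is called a proper boundary term if in addition there are $r'_g\in\mathbb N$, $D'_g>0$ with $b_g(\Lambda)\le D'_g|\partial^{r'_g}\Lambda|$ for all cubes $\Lambda$. $\mathcal U_{K,D,D',r'}$ is the set of admissible $g$ (having a proper boundary term $b_g$) with $K_g\le K$, $D_g\le D$, $D'_g\le D'$, $r'_g\le r'$. For $\Lambda\in\mathcal F$, $g_\Lambda\colon\Omega_\Lambda\to\mathbb B$ is defined by $g_\Lambda(\omega_\Lambda):=g(\Lambda,\omega)$ (well-defined by (ii)). For $n\ge m$, $T_{m,n}:=\{t\in m\mathbb Z^d:\Lambda_m+t\subseteq\Lambda_n\}$, and $L_{m,n}^{r,\omega}:=\frac1{|T_{m,n}|}\sum_{t\in T_{m,n}}\delta_{(\tau_t\omega)_{\Lambda_m^r}}$ is the empirical probability measure on $\Omega_{\Lambda_m^r}$. For a measure $\nu$ on $\Omega_\Lambda$, $\langle h,\nu\rangle:=\int_{\Omega_\Lambda}h(\omega)\,d\nu(\omega)\in\mathbb B$, taken pointwise in $E\in\mathbb R$, and $\langle h,\nu_1-\nu_2\rangle:=\langle h,\nu_1\rangle-\langle h,\nu_2\rangle$.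
   Formalization: The error bound is stated for r < m < n instead of all m < n, since for m = r its right side is undefined and for m < r it becomes negative for large n. *)

theory Defs
  imports "HOL-Probability.Probability"
begin

text \<open>The lattice \<open>\<int>\<^sup>d\<close> is the type \<open>int ^ 'd\<close> with \<open>d = CARD('d) \<ge> 1\<close>, and the alphabet \<open>{0, 1}\<close> is
  \<^typ>\<open>bool\<close> with its order \<open>False \<le> True\<close>, so that every function \<open>int ^ 'd \<Rightarrow> bool\<close> is an element
  of \<open>\<Omega>\<close>.\<close>

type_synonym 'd site = "int ^ 'd"
type_synonym 'd config = "int ^ 'd \<Rightarrow> bool"
type_synonym 'd field = "(int ^ 'd) set \<Rightarrow> (int ^ 'd \<Rightarrow> bool) \<Rightarrow> real \<Rightarrow> real"


subsection \<open>Lattice geometry\<close>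

definition l1_dist :: "'d::finite site \<Rightarrow> 'd site \<Rightarrow> nat" where
  "l1_dist x y = nat (\<Sum>i\<in>UNIV. \<bar>x $ i - y $ i\<bar>)"

text \<open>Distances of sets live in \<^typ>\<open>enat\<close>, so that the distance to the empty set is \<open>\<infinity>\<close>;
  for nonempty sets the infimum is a minimum, also if the sets are infinite.\<close>

definition set_dist :: "'d::finite site set \<Rightarrow> 'd site set \<Rightarrow> enat" where
  "set_dist A B = (INF x\<in>A. INF y\<in>B. enat (l1_dist x y))"

definition translate :: "'d::finite site set \<Rightarrow> 'd site \<Rightarrow> 'd site set" where
  "translate \<Lambda> z = (\<lambda>x. x + z) ` \<Lambda>"

definition cube :: "nat \<Rightarrow> 'd::finite site set" where
  "cube n = {x. \<forall>i. 0 \<le> x $ i \<and> x $ i < int n}"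

definition boundary_layer :: "nat \<Rightarrow> 'd::finite site set \<Rightarrow> 'd site set" where
  "boundary_layer r \<Lambda> = {x \<in> \<Lambda>. set_dist {x} (- \<Lambda>) \<le> enat r} \<union> {x \<in> - \<Lambda>. set_dist {x} \<Lambda> \<le> enat r}"

definition inner_part :: "nat \<Rightarrow> 'd::finite site set \<Rightarrow> 'd site set" where
  "inner_part r \<Lambda> = \<Lambda> - boundary_layer r \<Lambda>"


subsection \<open>Colourings and their laws\<close>

definition shift :: "'d::finite site \<Rightarrow> 'd config \<Rightarrow> 'd config" where
  "shift z \<omega> = (\<lambda>x. \<omega> (x + z))"

text \<open>The measurable space \<open>\<Omega>\<^sub>\<Lambda>\<close>; in particular \<open>config_space UNIV\<close> is \<open>\<Omega>\<close> with the product
  \<open>\<sigma>\<close>-algebra. The projection onto \<open>\<Omega>\<^sub>\<Lambda>\<close> is \<open>\<lambda>\<omega>. restrict \<omega> \<Lambda>\<close>.\<close>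

definition config_space :: "'d::finite site set \<Rightarrow> 'd config measure" where
  "config_space \<Lambda> = (\<Pi>\<^sub>M z\<in>\<Lambda>. count_space (UNIV :: bool set))"

definition marginal :: "'d::finite config measure \<Rightarrow> 'd site set \<Rightarrow> 'd config measure" where
  "marginal P \<Lambda> = distr P (config_space \<Lambda>) (\<lambda>\<omega>. restrict \<omega> \<Lambda>)"

definition M1 :: "'d::finite config measure \<Rightarrow> bool" where
  "M1 P \<longleftrightarrow> (\<forall>z. distr P P (shift z) = P)"

definition M2 :: "'d::finite config measure \<Rightarrow> ('d site \<Rightarrow> bool measure) \<Rightarrow> bool" where
  "M2 P \<mu> \<longleftrightarrow>
     (\<forall>z. sets (\<mu> z) = Pow UNIV \<and> sigma_finite_measure (\<mu> z)) \<and>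
     (\<forall>\<Lambda>. finite \<Lambda> \<longrightarrow> absolutely_continuous (\<Pi>\<^sub>M z\<in>\<Lambda>. \<mu> z) (marginal P \<Lambda>))"

definition marginal_density ::
    "'d::finite config measure \<Rightarrow> ('d site \<Rightarrow> bool measure) \<Rightarrow> 'd site set \<Rightarrow> 'd config \<Rightarrow> ennreal" where
  "marginal_density P \<mu> \<Lambda> = RN_deriv (\<Pi>\<^sub>M z\<in>\<Lambda>. \<mu> z) (marginal P \<Lambda>)"

definition M3 :: "'d::finite config measure \<Rightarrow> ('d site \<Rightarrow> bool measure) \<Rightarrow> nat \<Rightarrow> bool" where
  "M3 P \<mu> r \<longleftrightarrow>
     (\<forall>(n::nat) (L :: nat \<Rightarrow> 'd site set).
        1 \<le> n \<longrightarrow>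
        (\<forall>j\<in>{1..n}. finite (L j) \<and> L j \<noteq> {}) \<longrightarrow>
        (\<forall>i\<in>{1..n}. \<forall>j\<in>{1..n}. i \<noteq> j \<longrightarrow> enat r < set_dist (L i) (L j)) \<longrightarrow>
        (AE \<eta> in (\<Pi>\<^sub>M z\<in>(\<Union>j\<in>{1..n}. L j). \<mu> z).
           marginal_density P \<mu> (\<Union>j\<in>{1..n}. L j) \<eta> =
             (\<Prod>j\<in>{1..n}. marginal_density P \<mu> (L j) (restrict \<eta> (L j)))))"


subsection \<open>Admissible functions\<close>

definition rc_bounded :: "(real \<Rightarrow> real) set" where
  "rc_bounded = {F. (\<forall>E. continuous (at_right E) F) \<and> bounded (range F)}"

text \<open>Only meaningful for bounded functions.\<close>

definition sup_norm :: "(real \<Rightarrow> real) \<Rightarrow> real" where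
  "sup_norm F = (SUP E. \<bar>F E\<bar>)"

text \<open>Functions on \<open>\<F> \<times> \<Omega>\<close> are total in their set argument; all conditions below concern
  finite sets only.\<close>

definition boundary_term :: "'d::finite field \<Rightarrow> ('d site set \<Rightarrow> real) \<Rightarrow> real \<Rightarrow> bool" where
  "boundary_term g b D \<longleftrightarrow>
     (\<forall>\<Lambda>. finite \<Lambda> \<longrightarrow> 0 \<le> b \<Lambda>) \<and>
     (\<forall>\<omega> (n::nat) (L :: nat \<Rightarrow> 'd site set).
        1 \<le> n \<longrightarrow> (\<forall>i\<in>{1..n}. finite (L i)) \<longrightarrow> disjoint_family_on L {1..n} \<longrightarrow>
        sup_norm (\<lambda>E. g (\<Union>i\<in>{1..n}. L i) \<omega> E - (\<Sum>i\<in>{1..n}. g (L i) \<omega> E))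
          \<le> (\<Sum>i\<in>{1..n}. b (L i))) \<and>
     (\<forall>\<Lambda> z. finite \<Lambda> \<longrightarrow> b (translate \<Lambda> z) = b \<Lambda>) \<and>
     0 < D \<and> (\<forall>\<Lambda>. finite \<Lambda> \<longrightarrow> b \<Lambda> \<le> D * real (card \<Lambda>)) \<and>
     (\<forall>(N :: nat \<Rightarrow> nat) z. strict_mono N \<longrightarrow>
        (\<lambda>i. b (translate (cube (N i)) (z i)) / real (card (translate (cube (N i)) (z i) :: 'd site set)))
          \<longlonglongrightarrow> 0)"

definition proper_boundary :: "('d::finite site set \<Rightarrow> real) \<Rightarrow> real \<Rightarrow> nat \<Rightarrow> bool" where
  "proper_boundary b D' r' \<longleftrightarrow> 1 \<le> r' \<and> 0 < D' \<and>
     (\<forall>n z. 1 \<le> n \<longrightarrow>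
        b (translate (cube n) z) \<le> D' * real (card (boundary_layer r' (translate (cube n) z))))"

definition admissible :: "'d::finite field \<Rightarrow> bool" where
  "admissible g \<longleftrightarrow>
     (\<forall>\<Lambda> \<omega>. finite \<Lambda> \<longrightarrow> g \<Lambda> \<omega> \<in> rc_bounded) \<and>
     (\<forall>\<Lambda> z \<omega>. finite \<Lambda> \<longrightarrow> g (translate \<Lambda> z) \<omega> = g \<Lambda> (shift z \<omega>)) \<and>
     (\<forall>\<Lambda> \<omega> \<omega>'. finite \<Lambda> \<longrightarrow> restrict \<omega> \<Lambda> = restrict \<omega>' \<Lambda> \<longrightarrow> g \<Lambda> \<omega> = g \<Lambda> \<omega>') \<and>
     (\<exists>b D. boundary_term g b D) \<and>
     (\<exists>s :: 'd site \<Rightarrow> int. (\<forall>z. s z \<in> {-1, 1}) \<and>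
        (\<forall>\<Lambda> \<omega> \<omega>' z E. finite \<Lambda> \<longrightarrow> z \<in> \<Lambda> \<longrightarrow>
           restrict \<omega> (\<Lambda> - {z}) = restrict \<omega>' (\<Lambda> - {z}) \<longrightarrow> \<omega> z \<le> \<omega>' z \<longrightarrow>
           (s z = 1 \<longrightarrow> g \<Lambda> \<omega> E \<le> g \<Lambda> \<omega>' E) \<and>
           (s z = -1 \<longrightarrow> g \<Lambda> \<omega>' E \<le> g \<Lambda> \<omega> E))) \<and>
     bdd_above (range (\<lambda>\<omega>. sup_norm (g {0} \<omega>)))"

text \<open>Properties (iii) and (v) make this supremum finite for admissible \<open>g\<close>.\<close>

definition growth_const :: "'d::finite field \<Rightarrow> real" where
  "growth_const g = Sup {sup_norm (g \<Lambda> \<omega>) / real (card \<Lambda>) |\<Lambda> \<omega>. finite \<Lambda> \<and> \<Lambda> \<noteq> {}}"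

text \<open>The boundary term of \<open>g\<close> and its constants are not determined by \<open>g\<close>: membership
  means that they can be chosen within the given bounds.\<close>

definition admissible_class :: "real \<Rightarrow> real \<Rightarrow> real \<Rightarrow> nat \<Rightarrow> 'd::finite field set" where
  "admissible_class K D D' r' =
     {g. admissible g \<and> growth_const g \<le> K \<and>
         (\<exists>b D0 D0' r0'. boundary_term g b D0 \<and> proper_boundary b D0' r0' \<and>
            D0 \<le> D \<and> D0' \<le> D' \<and> r0' \<le> r')}"


subsection \<open>Empirical measures\<close>

definition tiling :: "nat \<Rightarrow> nat \<Rightarrow> 'd::finite site set" where
  "tiling m n = {t \<in> range (\<lambda>k. int m *s k). translate (cube m) t \<subseteq> cube n}"

definition empirical :: "nat \<Rightarrow> nat \<Rightarrow> nat \<Rightarrow> 'd::finite config \<Rightarrow> 'd config measure" where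
  "empirical m n r \<omega> =
     distr (uniform_count_measure (tiling m n)) (config_space (inner_part r (cube m)))
       (\<lambda>t. restrict (shift t \<omega>) (inner_part r (cube m)))"

text \<open>For \<open>g\<close> depending only on the colours in \<open>\<Lambda>\<close>, \<open>g\<^sub>\<Lambda>\<close> is \<open>g \<Lambda>\<close> itself: an element of \<open>\<Omega>\<^sub>\<Lambda>\<close> is an
  extensional function and thus also an element of \<open>\<Omega>\<close>.\<close>

definition pairing :: "('d::finite config \<Rightarrow> real \<Rightarrow> real) \<Rightarrow> 'd config measure \<Rightarrow> real \<Rightarrow> real" where
  "pairing h \<nu> = (\<lambda>E. \<integral>\<eta>. h \<eta> E \<partial>\<nu>)"


subsection \<open>Cluster counting\<close>

definition perc_edges :: "'d::finite config \<Rightarrow> ('d site \<times> 'd site) set" where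
  "perc_edges \<omega> = {(x, y). l1_dist x y = 1 \<and> \<omega> x \<and> \<omega> y}"

definition cluster :: "'d::finite site set \<Rightarrow> 'd config \<Rightarrow> 'd site \<Rightarrow> 'd site set" where
  "cluster \<Lambda> \<omega> x = {y. (x, y) \<in> (perc_edges \<omega> \<inter> \<Lambda> \<times> \<Lambda>)\<^sup>*}"

definition cluster_count :: "'d::finite field" where
  "cluster_count \<Lambda> \<omega> l =
     real (card {cluster \<Lambda> \<omega> z |z. z \<in> \<Lambda> \<and> real (card (cluster \<Lambda> \<omega> z)) \<le> l})"

end

theory Submission
  imports Defs
begin

text \<open>
  Write \<open>f\<close> for the cluster counting function and \<open>d\<close> for the dimension. Three properties of \<open>f\<close>
  carry the proof.

  First, \<open>f\<close> is almost additive (\<open>cluster_count_almost_additive\<close>): the clusters of a disjoint union and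
  the clusters of its parts differ only in clusters that touch the inner boundary of a part, and disjoint
  clusters touch it in different sites. Cutting the cube \<open>\<Lambda>\<^sub>n\<close> into the cubes \<open>\<Lambda>\<^sub>m + t\<close>, shrinking
  each of these by \<open>r\<close>, and counting boundary sites and left-over sites bounds the distance
  between \<open>f(\<Lambda>\<^sub>n, \<omega>)/n\<^sup>d\<close> and the average of \<open>f(\<Lambda>\<^sub>m\<^sup>r, \<tau>\<^sub>t\<omega>)/m\<^sup>d\<close> over \<open>t\<close> by
  \<open>3dm/n + (4dr + 2d)/m\<close>, uniformly in \<open>\<omega>\<close> and in the level (\<open>cluster_density_tile_average\<close>).

  Second, \<open>f(\<Lambda>, \<omega>)\<close> depends on finitely many colours from a finite alphabet, so a law of large numbers for
  \<open>f\<close> only needs the frequencies of finitely many patterns. The shrunken cubes are further than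
  \<open>r\<close> apart, so the product structure of the densities makes the occurrences of a pattern in different
  tiles independent, and by stationarity equally likely. Hoeffding's inequality and the Borel--Cantelli lemma
  then yield almost sure convergence of all tile averages to the expectations
  \<open>F\<^sub>m = (\<integral> f(\<Lambda>\<^sub>m\<^sup>r, \<omega>) dP)/m\<^sup>d\<close> (\<open>tile_averages_converge\<close>).

  Third, \<open>f(\<Lambda>, \<omega>)\<close> is a step function that can only jump at the integers \<open>1, \<dots>, |\<Lambda>|\<close>
  (\<open>cluster_count_step\<close>), so that pointwise convergence in the level is uniform.

  Letting \<open>n \<rightarrow> \<infinity>\<close> in the first estimate at a typical \<open>\<omega>\<close> shows that \<open>F\<^sub>m\<close> is a Cauchy sequence, and that
  its limit \<open>f\<^sup>*\<close> satisfies \<open>|F\<^sub>m - f\<^sup>*| \<le> (4dr + 2d)/m\<close>. Together with the first estimate at finite \<open>n\<close>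
  this gives the error bound, with the difference between tile average and expectation as the remaining term.
  Since \<open>f\<close> itself is admissible with the required constants (\<open>cluster_count_in_admissible_class\<close>), that
  term is one of those over which the supremum is taken, and these terms are bounded because the growth constant
  controls all members of the class (\<open>bdd_above_pairing_difference\<close>). For \<open>r < m \<le> 2r\<close> the set
  \<open>\<Lambda>\<^sub>m\<^sup>r\<close> is empty, but then the explicit error term exceeds \<open>1\<close>, which is a bound for the
  distance of any two densities.
\<close>

section \<open>Boxes, tilings and inner boundaries\<close>

lemma set_dist_le_iff: "set_dist A B \<le> enat k \<longleftrightarrow> (\<exists>x\<in>A. \<exists>y\<in>B. l1_dist x y \<le> k)"
proof -
  have less: "a \<le> enat k \<longleftrightarrow> a < enat (Suc k)" for a
    by (cases a) auto
  show ?thesis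
    unfolding set_dist_def less INF_less_iff by (auto simp: less_Suc_eq_le)
qed

lemma coordinate_le_l1_dist: "\<bar>x $ i - y $ i\<bar> \<le> int (l1_dist x y)"
proof -
  have "\<bar>x $ i - y $ i\<bar> \<le> (\<Sum>i\<in>UNIV. \<bar>x $ i - y $ i\<bar>)"
    by (rule member_le_sum) auto
  then show ?thesis
    by (simp add: l1_dist_def)
qed

lemma l1_dist_update_coordinate: "l1_dist x (\<chi> j. if j = i then v else x $ j) = nat \<bar>x $ i - v\<bar>"
proof -
  have "(\<Sum>j\<in>UNIV. \<bar>x $ j - (\<chi> j. if j = i then v else x $ j) $ j\<bar>)
      = (\<Sum>j\<in>UNIV. if j = i then \<bar>x $ i - v\<bar> else 0)"
    by (rule sum.cong) auto
  then show ?thesis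
    by (simp add: l1_dist_def)
qed

lemma l1_dist_translate: "l1_dist (x + t) (y + t) = l1_dist x y"
  by (simp add: l1_dist_def)

lemma l1_dist_commute: "l1_dist x y = l1_dist y x"
  by (simp add: l1_dist_def abs_minus_commute)

definition lattice_box :: "int \<Rightarrow> int \<Rightarrow> 'd::finite site set" where
  "lattice_box a b = {x. \<forall>i. a \<le> x $ i \<and> x $ i < b}"

lemma translate_iff: "x \<in> translate \<Lambda> z \<longleftrightarrow> x - z \<in> \<Lambda>"
proof
  assume "x - z \<in> \<Lambda>"
  then have "x - z + z \<in> translate \<Lambda> z"
    unfolding translate_def by (rule imageI)
  then show "x \<in> translate \<Lambda> z"
    by simp
qed (auto simp: translate_def)

lemma cube_eq_lattice_box: "cube n = lattice_box 0 (int n)"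
  by (simp add: cube_def lattice_box_def)

lemma bij_betw_lattice_box:
  "bij_betw vec_nth (lattice_box a b :: 'd::finite site set) (PiE UNIV (\<lambda>_. {a..<b}))"
  by (rule bij_betwI[where g = vec_lambda]) (auto simp: lattice_box_def PiE_iff)

lemma card_lattice_box: "card (lattice_box a b :: 'd::finite site set) = nat (b - a) ^ CARD('d)"
  using bij_betw_same_card[OF bij_betw_lattice_box[of a b]] by (simp add: card_PiE)

lemma finite_lattice_box [simp]: "finite (lattice_box a b :: 'd::finite site set)"
  using bij_betw_finite[OF bij_betw_lattice_box[of a b]] by (simp add: finite_PiE)

lemma finite_cube [simp]: "finite (cube n)"
  by (simp add: cube_eq_lattice_box)

lemma card_cube: "card (cube n :: 'd::finite site set) = n ^ CARD('d)"
  by (simp add: cube_eq_lattice_box card_lattice_box)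

lemma inner_part_cube: "inner_part r (cube m) = lattice_box (int r) (int m - int r)"
proof (intro set_eqI iffI)
  fix x :: "'a site"
  assume "x \<in> inner_part r (cube m)"
  then have x: "x \<in> cube m" and far: "\<And>y. y \<notin> cube m \<Longrightarrow> \<not> l1_dist x y \<le> r"
    by (auto simp: inner_part_def boundary_layer_def set_dist_le_iff)
  show "x \<in> lattice_box (int r) (int m - int r)"
    unfolding lattice_box_def
  proof (intro CollectI allI)
    fix i
    \<comment> \<open>Leaving the cube through either of its two faces orthogonal to direction \<open>i\<close>.\<close>
    have "\<not> l1_dist x (\<chi> j. if j = i then -1 else x $ j) \<le> r"
      by (rule far) (auto simp: cube_def intro!: exI[of _ i])
    moreover have "\<not> l1_dist x (\<chi> j. if j = i then int m else x $ j) \<le> r"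
      by (rule far) (auto simp: cube_def intro!: exI[of _ i])
    moreover have "0 \<le> x $ i \<and> x $ i < int m"
      using x by (simp add: cube_def)
    ultimately show "int r \<le> x $ i \<and> x $ i < int m - int r"
      unfolding l1_dist_update_coordinate by linarith
  qed
next
  fix x :: "'a site"
  assume x: "x \<in> lattice_box (int r) (int m - int r)"
  have "\<not> l1_dist x y \<le> r" if y: "y \<notin> cube m" for y
  proof -
    obtain i where "y $ i < 0 \<or> int m \<le> y $ i"
      using y by (auto simp: cube_def not_le not_less)
    moreover have "int r \<le> x $ i \<and> x $ i < int m - int r"
      using x by (simp add: lattice_box_def)
    ultimately show ?thesis
      using coordinate_le_l1_dist[of x i y] by linarith
  qed
  moreover have "x \<in> cube m"
  proof -
    have "0 \<le> x $ i \<and> x $ i < int m" for i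
      using x[unfolded lattice_box_def, THEN CollectD, THEN spec, of i] by linarith
    then show ?thesis
      by (simp add: cube_def)
  qed
  ultimately show "x \<in> inner_part r (cube m)"
    by (auto simp: inner_part_def boundary_layer_def set_dist_le_iff)
qed

lemma finite_inner_part_cube [simp]: "finite (inner_part r (cube m))"
  by (simp add: inner_part_cube)

lemma tiling_eq:
  assumes "1 \<le> m"
  shows "(tiling m n :: 'd::finite site set) = (\<lambda>k. int m *s k) ` cube (n div m)"
proof -
  have "translate (cube m) (int m *s k) \<subseteq> cube n \<longleftrightarrow> k \<in> cube (n div m)" for k :: "'d site"
  proof
    assume sub: "translate (cube m) (int m *s k) \<subseteq> cube n"
    have "(\<chi> i. c) + int m *s k \<in> cube n" if "0 \<le> c" "c < int m" for c
    proof -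
      have "(\<chi> i. c) + int m *s k \<in> translate (cube m) (int m *s k)"
        using that by (auto simp: translate_def cube_def)
      then show ?thesis
        using sub by blast
    qed
    from this[of 0] this[of "int m - 1"] assms
    have "\<forall>i. 0 \<le> int m * k $ i" "\<forall>i. int m - 1 + int m * k $ i < int n"
      by (auto simp: cube_def)
    then have *: "0 \<le> int m * k $ i \<and> int m * k $ i + int m \<le> int n" for i
      by (smt (verit))
    have "0 \<le> k $ i \<and> k $ i < int (n div m)" for i
    proof -
      have "0 \<le> k $ i"
        using *[of i] assms by (simp add: zero_le_mult_iff)
      moreover have "(k $ i + 1) * int m \<le> int n"
        using *[of i] by (simp add: algebra_simps)
      then have "k $ i + 1 \<le> int n div int m"
        using assms zdiv_mono1[of "(k $ i + 1) * int m" "int n" "int m"] by simp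
      ultimately show ?thesis
        by (simp add: zdiv_int)
    qed
    then show "k \<in> cube (n div m)"
      by (simp add: cube_def)
  next
    assume k: "k \<in> cube (n div m)"
    show "translate (cube m) (int m *s k) \<subseteq> cube n"
      unfolding translate_def cube_def
    proof (clarsimp)
      fix x :: "'d site" and i
      assume x: "\<forall>i. 0 \<le> x $ i \<and> x $ i < int m"
      have k': "0 \<le> k $ i" "k $ i + 1 \<le> int (n div m)"
        using k[unfolded cube_def, THEN CollectD, THEN spec, of i] by linarith+
      have "int m * (k $ i + 1) \<le> int m * int (n div m)"
        using k' by (intro mult_left_mono) auto
      also have "\<dots> \<le> int n"
        by (simp flip: of_nat_mult)
      finally have "int m * k $ i + int m \<le> int n"
        by (simp add: algebra_simps)
      moreover have "0 \<le> int m * k $ i"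
        using k' by simp
      ultimately show "0 \<le> x $ i + int m * k $ i \<and> x $ i + int m * k $ i < int n"
        using x[rule_format, of i] by linarith
    qed
  qed
  then show ?thesis
    by (auto simp: tiling_def)
qed

lemma finite_tiling [simp]: "1 \<le> m \<Longrightarrow> finite (tiling m n)"
  by (simp add: tiling_eq)

lemma card_tiling:
  assumes "1 \<le> m"
  shows "card (tiling m n :: 'd::finite site set) = (n div m) ^ CARD('d)"
proof -
  have "inj_on (\<lambda>k. int m *s k) (cube (n div m) :: 'd site set)"
    using assms by (auto simp: inj_on_def vec_eq_iff)
  then show ?thesis
    by (simp add: tiling_eq[OF assms] card_image card_cube)
qed

lemma tiling_nonempty:
  assumes "1 \<le> m" "m \<le> n"
  shows "(tiling m n :: 'd::finite site set) \<noteq> {}"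
proof -
  have "0 < n div m"
    using assms by (simp add: div_greater_zero_iff)
  then have "0 < card (tiling m n :: 'd site set)"
    by (simp add: card_tiling[OF assms(1)])
  then show ?thesis
    by force
qed

text \<open>Two points in distinct tiles keep a distance of \<open>r\<close> from the boundaries of their tiles,
  so that the gap between them consists of at least \<open>2r\<close> sites.\<close>

lemma tiles_far_apart:
  assumes "1 \<le> m" "s \<in> tiling m n" "t \<in> tiling m n" "s \<noteq> t"
    and "x \<in> translate (inner_part r (cube m)) s" "y \<in> translate (inner_part r (cube m)) t"
  shows "r < l1_dist x y"
proof -
  obtain k l where k: "s = int m *s k" and l: "t = int m *s l"
    using assms(1-3) by (auto simp: tiling_eq)
  obtain u v where u: "u \<in> lattice_box (int r) (int m - int r)" "x = u + s"
    and v: "v \<in> lattice_box (int r) (int m - int r)" "y = v + t"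
    using assms(5,6) by (auto simp: translate_def inner_part_cube)
  obtain i where i: "k $ i \<noteq> l $ i"
    using assms(4) k l by (metis vec_eq_iff)
  have ui: "int r \<le> u $ i \<and> u $ i < int m - int r"
    using u by (simp add: lattice_box_def)
  have vi: "int r \<le> v $ i \<and> v $ i < int m - int r"
    using v by (simp add: lattice_box_def)
  have "int m * 1 \<le> int m * \<bar>k $ i - l $ i\<bar>"
    using i by (intro mult_left_mono) auto
  also have "\<dots> = \<bar>s $ i - t $ i\<bar>"
    by (simp add: k l abs_mult flip: right_diff_distrib)
  finally have "int m \<le> \<bar>s $ i - t $ i\<bar>"
    by simp
  moreover have "x $ i = u $ i + s $ i" "y $ i = v $ i + t $ i"
    by (simp_all add: u v)
  ultimately have "int r < \<bar>x $ i - y $ i\<bar>"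
    using ui vi by linarith
  then show ?thesis
    using coordinate_le_l1_dist[of x i y] by linarith
qed

lemma tiles_disjoint:
  assumes "1 \<le> m"
  shows "disjoint_family_on (\<lambda>t. translate (inner_part r (cube m)) t) (tiling m n)"
  unfolding disjoint_family_on_def
proof (intro ballI impI)
  fix s t :: "'a site"
  assume "s \<in> tiling m n" "t \<in> tiling m n" "s \<noteq> t"
  note far = tiles_far_apart[OF assms this]
  show "translate (inner_part r (cube m)) s \<inter> translate (inner_part r (cube m)) t = {}"
  proof (rule equals0I)
    fix x
    assume "x \<in> translate (inner_part r (cube m)) s \<inter> translate (inner_part r (cube m)) t"
    then have "r < l1_dist x x"
      by (intro far) auto
    then show False
      by (simp add: l1_dist_def)
  qed
qed

lemma inner_part_subset: "inner_part r \<Lambda> \<subseteq> \<Lambda>"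
  by (auto simp: inner_part_def)

lemma tile_subset_cube: "t \<in> tiling m n \<Longrightarrow> translate (inner_part r (cube m)) t \<subseteq> cube n"
  using inner_part_subset[of r "cube m"] unfolding tiling_def translate_def by blast

lemma finite_translate [simp]: "finite (translate \<Lambda> z) \<longleftrightarrow> finite \<Lambda>"
  by (simp add: translate_def finite_image_iff)

lemma card_translate [simp]: "card (translate \<Lambda> z) = card \<Lambda>"
  by (simp add: translate_def card_image)


definition inner_boundary :: "'d::finite site set \<Rightarrow> 'd site set" where
  "inner_boundary \<Lambda> = {x \<in> \<Lambda>. \<exists>y. y \<notin> \<Lambda> \<and> l1_dist x y = 1}"

lemma inner_boundary_subset: "inner_boundary \<Lambda> \<subseteq> \<Lambda>"
  by (auto simp: inner_boundary_def)

lemma inner_boundary_translate: "inner_boundary (translate \<Lambda> z) = translate (inner_boundary \<Lambda>) z"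
proof -
  have "(\<exists>y. y - z \<notin> \<Lambda> \<and> l1_dist x y = 1) \<longleftrightarrow> (\<exists>y. y \<notin> \<Lambda> \<and> l1_dist (x - z) y = 1)" for x
    by (metis add_diff_cancel_right' diff_add_cancel l1_dist_translate)
  then show ?thesis
    by (auto simp: inner_boundary_def translate_iff)
qed

lemma inner_boundary_lattice_box: "inner_boundary (lattice_box a b) \<subseteq> lattice_box a b - lattice_box (a + 1) (b - 1)"
proof -
  have "y \<in> lattice_box a b" if x: "x \<in> lattice_box (a + 1) (b - 1)" and xy: "l1_dist x y = 1" for x y :: "'a site"
    unfolding lattice_box_def
  proof (intro CollectI allI)
    fix i
    show "a \<le> y $ i \<and> y $ i < b"
      using x[unfolded lattice_box_def, THEN CollectD, THEN spec, of i] coordinate_le_l1_dist[of x i y] xy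
      by linarith
  qed
  then show ?thesis
    by (auto simp: inner_boundary_def)
qed

lemma power_diff_le:
  fixes a b :: real
  assumes "0 \<le> a" "a \<le> b"
  shows "b ^ k - a ^ k \<le> real k * (b - a) * b ^ (k - 1)"
proof (cases "k = 0")
  case False
  have "b ^ k - a ^ k = (b - a) * (\<Sum>i<k. a ^ (k - Suc i) * b ^ i)"
    using False by (simp add: power_diff_sumr2[of b k a] mult.commute)
  also have "\<dots> \<le> (b - a) * (\<Sum>i<k. b ^ (k - 1))"
  proof (intro mult_left_mono sum_mono)
    fix i assume i: "i \<in> {..<k}"
    have "a ^ (k - Suc i) * b ^ i \<le> b ^ (k - Suc i) * b ^ i"
      using assms by (intro mult_right_mono power_mono) auto
    also have "\<dots> = b ^ (k - 1)"
      using i by (simp flip: power_add)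
    finally show "a ^ (k - Suc i) * b ^ i \<le> b ^ (k - 1)" .
  qed (use assms in simp)
  finally show ?thesis
    by (simp add: mult_ac)
qed simp

text \<open>The inner boundary of a box lies in its outermost layer, i.e. outside of the concentric box whose sides
  are shorter by \<open>2\<close>.\<close>

lemma card_inner_boundary_lattice_box:
  assumes "b - a = int s"
  shows "real (card (inner_boundary (lattice_box a b :: 'd::finite site set)))
    \<le> 2 * real CARD('d) * real s ^ (CARD('d) - 1)"
proof -
  have sub: "(lattice_box (a + 1) (b - 1) :: 'd site set) \<subseteq> lattice_box a b"
    unfolding lattice_box_def
  proof clarsimp
    fix x :: "'d site" and i
    assume "\<forall>i. a + 1 \<le> x $ i \<and> x $ i < b - 1"
    from this[rule_format, of i] show "a \<le> x $ i \<and> x $ i < b"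
      by linarith
  qed
  have "card (inner_boundary (lattice_box a b :: 'd site set))
      \<le> card (lattice_box a b - lattice_box (a + 1) (b - 1) :: 'd site set)"
    by (intro card_mono inner_boundary_lattice_box) auto
  also have "\<dots> = s ^ CARD('d) - (s - 2) ^ CARD('d)"
  proof -
    have "nat (b - 1 - (a + 1)) = s - 2"
      using assms by linarith
    then show ?thesis
      using sub assms by (subst card_Diff_subset) (auto simp: card_lattice_box)
  qed
  finally have "real (card (inner_boundary (lattice_box a b :: 'd site set)))
      \<le> real (s ^ CARD('d) - (s - 2) ^ CARD('d))"
    by (rule of_nat_mono)
  also have "\<dots> = real s ^ CARD('d) - real (s - 2) ^ CARD('d)"
    by (simp add: of_nat_diff power_mono)
  also have "\<dots> \<le> real CARD('d) * (real s - real (s - 2)) * real s ^ (CARD('d) - 1)"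
    by (rule power_diff_le) auto
  also have "\<dots> \<le> real CARD('d) * 2 * real s ^ (CARD('d) - 1)"
    by (intro mult_right_mono mult_left_mono) auto
  finally show ?thesis
    by (simp add: mult_ac)
qed

lemma finite_boundary_layer:
  fixes \<Lambda> :: "'d::finite site set"
  assumes "finite \<Lambda>"
  shows "finite (boundary_layer r \<Lambda>)"
proof -
  have "boundary_layer r \<Lambda> \<subseteq> \<Lambda> \<union> (\<Union>y\<in>\<Lambda>. translate (lattice_box (- int r) (int r + 1)) y)"
  proof
    fix x
    assume x: "x \<in> boundary_layer r \<Lambda>"
    show "x \<in> \<Lambda> \<union> (\<Union>y\<in>\<Lambda>. translate (lattice_box (- int r) (int r + 1)) y)"
    proof (cases "x \<in> \<Lambda>")
      case False
      then obtain y where y: "y \<in> \<Lambda>" "l1_dist x y \<le> r"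
        using x by (auto simp: boundary_layer_def set_dist_le_iff)
      have "- int r \<le> x $ i - y $ i \<and> x $ i - y $ i < int r + 1" for i
        using coordinate_le_l1_dist[of x i y] y by linarith
      then show ?thesis
        using y by (auto simp: translate_iff lattice_box_def)
    qed auto
  qed
  then show ?thesis
    by (rule finite_subset) (use assms in auto)
qed

lemma card_inner_boundary_le_boundary_layer:
  assumes "finite \<Lambda>"
  shows "card (inner_boundary \<Lambda>) \<le> card (boundary_layer 1 \<Lambda>)"
  by (rule card_mono[OF finite_boundary_layer[OF assms]])
     (auto simp: inner_boundary_def boundary_layer_def set_dist_le_iff intro: eq_imp_le)

section \<open>Cluster counting is almost additive and monotone\<close>

definition clusters_upto :: "'d::finite site set \<Rightarrow> 'd config \<Rightarrow> real \<Rightarrow> 'd site set set" where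
  "clusters_upto \<Lambda> \<omega> l = {cluster \<Lambda> \<omega> z |z. z \<in> \<Lambda> \<and> real (card (cluster \<Lambda> \<omega> z)) \<le> l}"

lemma cluster_count_eq: "cluster_count \<Lambda> \<omega> l = real (card (clusters_upto \<Lambda> \<omega> l))"
  by (simp add: cluster_count_def clusters_upto_def)

lemma cluster_self: "x \<in> cluster \<Lambda> \<omega> x"
  by (simp add: cluster_def)

lemma cluster_subset:
  assumes "x \<in> \<Lambda>"
  shows "cluster \<Lambda> \<omega> x \<subseteq> \<Lambda>"
proof
  fix y
  assume "y \<in> cluster \<Lambda> \<omega> x"
  then have "(x, y) \<in> (perc_edges \<omega> \<inter> \<Lambda> \<times> \<Lambda>)\<^sup>*"
    by (simp add: cluster_def)
  then show "y \<in> \<Lambda>"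
    by (cases rule: rtranclE) (use assms in auto)
qed

lemma cluster_eq_if_mem:
  assumes "y \<in> cluster \<Lambda> \<omega> x"
  shows "cluster \<Lambda> \<omega> y = cluster \<Lambda> \<omega> x"
proof -
  let ?R = "perc_edges \<omega> \<inter> \<Lambda> \<times> \<Lambda>"
  have "sym ?R"
    by (auto simp: sym_def perc_edges_def l1_dist_commute)
  then have "sym (?R\<^sup>*)"
    by (rule sym_rtrancl)
  moreover have "(x, y) \<in> ?R\<^sup>*"
    using assms by (simp add: cluster_def)
  ultimately have "(x, y) \<in> ?R\<^sup>*" "(y, x) \<in> ?R\<^sup>*"
    by (auto dest: symD)
  then show ?thesis
    by (auto simp: cluster_def intro: rtrancl_trans)
qed

lemma clusters_upto_mem_eq: "C \<in> clusters_upto \<Lambda> \<omega> l \<Longrightarrow> x \<in> C \<Longrightarrow> C = cluster \<Lambda> \<omega> x"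
  by (auto simp: clusters_upto_def cluster_eq_if_mem)

lemma clusters_upto_disjoint:
  assumes "C \<in> clusters_upto \<Lambda> \<omega> l" "D \<in> clusters_upto \<Lambda> \<omega> l'" "C \<inter> D \<noteq> {}"
  shows "C = D"
proof -
  obtain x where "x \<in> C" "x \<in> D"
    using assms(3) by blast
  then show ?thesis
    using assms(1,2) clusters_upto_mem_eq by metis
qed

lemma clusters_upto_nonempty: "C \<in> clusters_upto \<Lambda> \<omega> l \<Longrightarrow> C \<noteq> {}"
  using cluster_self by (force simp: clusters_upto_def)

lemma clusters_upto_subset: "C \<in> clusters_upto \<Lambda> \<omega> l \<Longrightarrow> C \<subseteq> \<Lambda>"
  using cluster_subset by (force simp: clusters_upto_def)

lemma clusters_upto_card: "C \<in> clusters_upto \<Lambda> \<omega> l \<Longrightarrow> real (card C) \<le> l"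
  by (auto simp: clusters_upto_def)

lemma finite_clusters_upto [simp]: "finite \<Lambda> \<Longrightarrow> finite (clusters_upto \<Lambda> \<omega> l)"
  by (simp add: clusters_upto_def)

lemma cluster_count_nonneg: "0 \<le> cluster_count \<Lambda> \<omega> l"
  by (simp add: cluster_count_eq)

lemma cluster_count_le_card:
  assumes "finite \<Lambda>"
  shows "cluster_count \<Lambda> \<omega> l \<le> real (card \<Lambda>)"
proof -
  have "card (clusters_upto \<Lambda> \<omega> l) \<le> card (cluster \<Lambda> \<omega> ` \<Lambda>)"
    by (rule card_mono) (use assms in \<open>auto simp: clusters_upto_def\<close>)
  also have "\<dots> \<le> card \<Lambda>"
    using assms by (rule card_image_le)
  finally show ?thesis
    by (simp add: cluster_count_eq)
qed

lemma cluster_count_local: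
  assumes "restrict \<omega> \<Lambda> = restrict \<omega>' \<Lambda>"
  shows "cluster_count \<Lambda> \<omega> = cluster_count \<Lambda> \<omega>'"
proof -
  have "\<omega> x = \<omega>' x" if "x \<in> \<Lambda>" for x
    using assms that by (metis restrict_apply')
  then have "perc_edges \<omega> \<inter> \<Lambda> \<times> \<Lambda> = perc_edges \<omega>' \<inter> \<Lambda> \<times> \<Lambda>"
    by (auto simp: perc_edges_def)
  then show ?thesis
    by (simp add: cluster_count_def cluster_def fun_eq_iff)
qed

lemma cluster_count_restrict: "cluster_count \<Lambda> (restrict \<omega> \<Lambda>) = cluster_count \<Lambda> \<omega>"
  by (rule cluster_count_local) simp

text \<open>Cluster sizes are integers between \<open>1\<close> and \<open>card \<Lambda>\<close>, so the counting function is a step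
  function that is determined by its values at finitely many points.\<close>

lemma cluster_count_step:
  assumes "finite \<Lambda>"
  shows "cluster_count \<Lambda> \<omega> l = cluster_count \<Lambda> \<omega> (real (min (card \<Lambda>) (nat \<lfloor>l\<rfloor>)))"
proof -
  have "real (card C) \<le> l \<longleftrightarrow> real (card C) \<le> real (min (card \<Lambda>) (nat \<lfloor>l\<rfloor>))"
    if C: "C = cluster \<Lambda> \<omega> z" "z \<in> \<Lambda>" for C z
  proof -
    have "C \<subseteq> \<Lambda>"
      using C cluster_subset by auto
    then have "card C \<le> card \<Lambda>" "finite C"
      using assms by (auto intro: card_mono finite_subset)
    moreover have "C \<noteq> {}"
      using C cluster_self by auto
    ultimately have "0 < card C"
      by (simp add: card_gt_0_iff)
    have "real (card C) \<le> l \<longleftrightarrow> int (card C) \<le> \<lfloor>l\<rfloor>"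
      by (simp add: le_floor_iff)
    also have "\<dots> \<longleftrightarrow> card C \<le> nat \<lfloor>l\<rfloor>"
      using \<open>0 < card C\<close> by linarith
    finally show ?thesis
      using \<open>card C \<le> card \<Lambda>\<close> by simp
  qed
  then have "clusters_upto \<Lambda> \<omega> l = clusters_upto \<Lambda> \<omega> (real (min (card \<Lambda>) (nat \<lfloor>l\<rfloor>)))"
    unfolding clusters_upto_def by blast
  then show ?thesis
    by (simp add: cluster_count_eq)
qed

lemma cluster_translate:
  "cluster (translate \<Lambda> z) \<omega> (x + z) = translate (cluster \<Lambda> (shift z \<omega>) x) z"
proof -
  let ?R = "perc_edges (shift z \<omega>) \<inter> \<Lambda> \<times> \<Lambda>"
  let ?S = "perc_edges \<omega> \<inter> translate \<Lambda> z \<times> translate \<Lambda> z"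
  have edge: "(a, b) \<in> ?R \<longleftrightarrow> (a + z, b + z) \<in> ?S" for a b
    by (simp add: perc_edges_def shift_def translate_iff l1_dist_translate)
  have "(x + z, y + z) \<in> ?S\<^sup>*" if "(x, y) \<in> ?R\<^sup>*" for y
    using that
  proof induction
    case (step u v)
    then show ?case
      using edge[of u v] by (meson rtrancl_into_rtrancl)
  qed simp
  moreover have "(x, y - z) \<in> ?R\<^sup>*" if "(x + z, y) \<in> ?S\<^sup>*" for y
    using that
  proof induction
    case (step u v)
    then have "(u - z, v - z) \<in> ?R"
      using edge[of "u - z" "v - z"] by simp
    then show ?case
      using step.IH by (rule rtrancl_into_rtrancl[rotated])
  qed simp
  ultimately have "(x + z, y) \<in> ?S\<^sup>* \<longleftrightarrow> (x, y - z) \<in> ?R\<^sup>*" for y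
    by (metis add_diff_cancel_right' diff_add_cancel)
  then show ?thesis
    by (simp add: cluster_def translate_iff set_eq_iff)
qed

lemma cluster_count_translate: "cluster_count (translate \<Lambda> z) \<omega> = cluster_count \<Lambda> (shift z \<omega>)"
proof
  fix l
  have "clusters_upto (translate \<Lambda> z) \<omega> l = (\<lambda>C. translate C z) ` clusters_upto \<Lambda> (shift z \<omega>) l"
  proof (intro subset_antisym subsetI)
    fix C
    assume "C \<in> clusters_upto (translate \<Lambda> z) \<omega> l"
    then obtain y where y: "C = cluster (translate \<Lambda> z) \<omega> y" "y - z \<in> \<Lambda>" "real (card C) \<le> l"
      by (auto simp: clusters_upto_def translate_iff)
    have "C = translate (cluster \<Lambda> (shift z \<omega>) (y - z)) z"
      using cluster_translate[of \<Lambda> z \<omega> "y - z"] y(1) by simp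
    then show "C \<in> (\<lambda>C. translate C z) ` clusters_upto \<Lambda> (shift z \<omega>) l"
      using y(2,3) by (auto simp: clusters_upto_def)
  next
    fix C
    assume "C \<in> (\<lambda>C. translate C z) ` clusters_upto \<Lambda> (shift z \<omega>) l"
    then obtain x where x: "C = translate (cluster \<Lambda> (shift z \<omega>) x) z" "x \<in> \<Lambda>" "real (card C) \<le> l"
      by (auto simp: clusters_upto_def)
    then have "C = cluster (translate \<Lambda> z) \<omega> (x + z)"
      by (simp add: cluster_translate)
    then show "C \<in> clusters_upto (translate \<Lambda> z) \<omega> l"
      using x(2,3) by (auto simp: clusters_upto_def translate_iff intro!: exI[of _ "x + z"])
  qed
  moreover have "inj (\<lambda>C. translate C z)"
    unfolding translate_def by (rule inj_on_image) (auto simp: inj_on_def)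
  ultimately show "cluster_count (translate \<Lambda> z) \<omega> l = cluster_count \<Lambda> (shift z \<omega>) l"
    by (simp add: cluster_count_eq card_image inj_on_subset)
qed

lemma card_le_if_disjoint_meets:
  assumes "finite B" "\<And>C. C \<in> \<C> \<Longrightarrow> C \<inter> B \<noteq> {}"
    and disj: "\<And>C D. C \<in> \<C> \<Longrightarrow> D \<in> \<C> \<Longrightarrow> C \<inter> D \<noteq> {} \<Longrightarrow> C = D"
  shows "card \<C> \<le> card B"
proof -
  have "\<forall>C\<in>\<C>. \<exists>x. x \<in> C \<inter> B"
    using assms(2) by blast
  then obtain p where p: "\<And>C. C \<in> \<C> \<Longrightarrow> p C \<in> C \<inter> B"
    by metis
  have "inj_on p \<C>"
    using p disj by (intro inj_onI) (metis IntD1 IntI empty_iff)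
  then show ?thesis
    by (rule card_inj_on_le) (use p assms(1) in auto)
qed

text \<open>Opening sites merges clusters. Inside each cluster of the larger configuration one may choose a
  cluster of the smaller one, which is not larger, and distinct choices are disjoint.\<close>

lemma cluster_count_antimono:
  assumes "finite \<Lambda>" and le: "\<And>x. x \<in> \<Lambda> \<Longrightarrow> \<omega> x \<le> \<omega>' x"
  shows "cluster_count \<Lambda> \<omega>' l \<le> cluster_count \<Lambda> \<omega> l"
proof -
  have mono: "cluster \<Lambda> \<omega> x \<subseteq> cluster \<Lambda> \<omega>' x" for x
  proof -
    have "perc_edges \<omega> \<inter> \<Lambda> \<times> \<Lambda> \<subseteq> perc_edges \<omega>' \<inter> \<Lambda> \<times> \<Lambda>"
      using le by (auto simp: perc_edges_def)
    from rtrancl_mono[OF this] show ?thesis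
      by (auto simp: cluster_def)
  qed
  define p where "p C = (SOME x :: 'a site. x \<in> C)" for C
  have p: "p C \<in> C" if "C \<in> clusters_upto \<Lambda> \<omega>' l" for C
    using clusters_upto_nonempty[OF that] unfolding p_def by (simp add: some_in_eq)
  define \<phi> where "\<phi> C = cluster \<Lambda> \<omega> (p C)" for C
  have sub: "\<phi> C \<subseteq> C" if "C \<in> clusters_upto \<Lambda> \<omega>' l" for C
    using mono[of "p C"] clusters_upto_mem_eq[OF that p[OF that]] by (simp add: \<phi>_def)
  have "inj_on \<phi> (clusters_upto \<Lambda> \<omega>' l)"
  proof (rule inj_onI)
    fix C D
    assume CD: "C \<in> clusters_upto \<Lambda> \<omega>' l" "D \<in> clusters_upto \<Lambda> \<omega>' l" "\<phi> C = \<phi> D"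
    have "p C \<in> \<phi> C"
      by (simp add: \<phi>_def cluster_self)
    then have "p C \<in> C \<inter> D"
      using sub CD by auto
    then show "C = D"
      using clusters_upto_disjoint[OF CD(1,2)] by auto
  qed
  moreover have "\<phi> ` clusters_upto \<Lambda> \<omega>' l \<subseteq> clusters_upto \<Lambda> \<omega> l"
  proof clarify
    fix C
    assume C: "C \<in> clusters_upto \<Lambda> \<omega>' l"
    have "C \<subseteq> \<Lambda>"
      using C by (rule clusters_upto_subset)
    then have "card (\<phi> C) \<le> card C"
      using sub[OF C] assms(1) by (intro card_mono) (auto intro: finite_subset)
    then have "real (card (\<phi> C)) \<le> l"
      using clusters_upto_card[OF C] by linarith
    then show "\<phi> C \<in> clusters_upto \<Lambda> \<omega> l"
      using p[OF C] \<open>C \<subseteq> \<Lambda>\<close> by (auto simp: clusters_upto_def \<phi>_def)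
  qed
  ultimately have "card (clusters_upto \<Lambda> \<omega>' l) \<le> card (clusters_upto \<Lambda> \<omega> l)"
    by (rule card_inj_on_le) (simp add: assms(1))
  then show ?thesis
    by (simp add: cluster_count_eq)
qed

lemma cluster_mono_set: "L \<subseteq> \<Lambda> \<Longrightarrow> cluster L \<omega> x \<subseteq> cluster \<Lambda> \<omega> x"
  using rtrancl_mono[of "perc_edges \<omega> \<inter> L \<times> L" "perc_edges \<omega> \<inter> \<Lambda> \<times> \<Lambda>"]
  by (auto simp: cluster_def)

text \<open>A cluster can only grow beyond \<open>L\<close> through a site that has a neighbour outside of \<open>L\<close>.\<close>

lemma cluster_eq_if_avoids_inner_boundary:
  assumes "x \<in> L" "L \<subseteq> \<Lambda>" and avoid: "cluster L \<omega> x \<inter> inner_boundary L = {}"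
  shows "cluster \<Lambda> \<omega> x = cluster L \<omega> x"
proof
  show "cluster L \<omega> x \<subseteq> cluster \<Lambda> \<omega> x"
    using assms(2) by (rule cluster_mono_set)
  show "cluster \<Lambda> \<omega> x \<subseteq> cluster L \<omega> x"
  proof
    fix y
    assume "y \<in> cluster \<Lambda> \<omega> x"
    then have "(x, y) \<in> (perc_edges \<omega> \<inter> \<Lambda> \<times> \<Lambda>)\<^sup>*"
      by (simp add: cluster_def)
    then show "y \<in> cluster L \<omega> x"
    proof induction
      case (step y z)
      then have "y \<in> L" "y \<notin> inner_boundary L"
        using avoid cluster_subset[OF assms(1)] by auto
      then have "z \<in> L"
        using step by (auto simp: inner_boundary_def perc_edges_def)
      then have "(y, z) \<in> perc_edges \<omega> \<inter> L \<times> L"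
        using step \<open>y \<in> L\<close> by auto
      then show ?case
        using step by (auto simp: cluster_def intro: rtrancl_into_rtrancl)
    qed (simp add: cluster_self)
  qed
qed

text \<open>The clusters of a union and the clusters of its parts are two families of disjoint sets, and each
  cluster that belongs to only one of the families meets an inner boundary of some part.\<close>

lemma cluster_count_almost_additive:
  assumes "finite I" "\<And>i. i \<in> I \<Longrightarrow> finite (L i)" "disjoint_family_on L I"
  shows "\<bar>cluster_count (\<Union>i\<in>I. L i) \<omega> l - (\<Sum>i\<in>I. cluster_count (L i) \<omega> l)\<bar>
    \<le> (\<Sum>i\<in>I. real (card (inner_boundary (L i))))"
proof -
  define \<Lambda> where "\<Lambda> = (\<Union>i\<in>I. L i)"
  define B where "B = (\<Union>i\<in>I. inner_boundary (L i))"
  define \<C> where "\<C> = clusters_upto \<Lambda> \<omega> l"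
  define \<D> where "\<D> = (\<Union>i\<in>I. clusters_upto (L i) \<omega> l)"
  have fin: "finite \<Lambda>" "finite \<C>" "finite \<D>"
    using assms(1,2) by (auto simp: \<Lambda>_def \<C>_def \<D>_def)
  have finB: "finite (inner_boundary (L i))" if "i \<in> I" for i
    using assms(2)[OF that] inner_boundary_subset finite_subset by blast
  have sub: "L i \<subseteq> \<Lambda>" if "i \<in> I" for i
    using that by (auto simp: \<Lambda>_def)
  have parts_disj: "L i \<inter> L j = {}" if "i \<in> I" "j \<in> I" "i \<noteq> j" for i j
    using assms(3) that by (auto simp: disjoint_family_on_def)
  have \<D>_disj: "C = D" if CD: "C \<in> \<D>" "D \<in> \<D>" "C \<inter> D \<noteq> {}" for C D
  proof -
    obtain i j where ij: "i \<in> I" "j \<in> I" "C \<in> clusters_upto (L i) \<omega> l" "D \<in> clusters_upto (L j) \<omega> l"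
      using CD(1,2) unfolding \<D>_def by blast
    then have "i = j"
      using CD(3) parts_disj[of i j] clusters_upto_subset[of C] clusters_upto_subset[of D] by blast
    then show ?thesis
      using ij CD(3) clusters_upto_disjoint by blast
  qed
  have \<C>_disj: "C = D" if "C \<in> \<C>" "D \<in> \<C>" "C \<inter> D \<noteq> {}" for C D
    using that clusters_upto_disjoint unfolding \<C>_def by blast
  have meets_\<C>: "C \<inter> B \<noteq> {}" if C: "C \<in> \<C> - \<D>" for C
  proof
    assume avoid: "C \<inter> B = {}"
    obtain x where x: "C = cluster \<Lambda> \<omega> x" "x \<in> \<Lambda>" "real (card C) \<le> l"
      using C by (auto simp: \<C>_def clusters_upto_def)
    then obtain i where i: "i \<in> I" "x \<in> L i"
      by (auto simp: \<Lambda>_def)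
    have "cluster (L i) \<omega> x \<subseteq> C"
      unfolding x(1) by (rule cluster_mono_set[OF sub[OF i(1)]])
    then have "cluster (L i) \<omega> x \<inter> inner_boundary (L i) = {}"
      using avoid i(1) unfolding B_def by blast
    then have "C = cluster (L i) \<omega> x"
      unfolding x(1) using i sub by (intro cluster_eq_if_avoids_inner_boundary) auto
    then have "C \<in> \<D>"
      using i x(3) by (auto simp: \<D>_def clusters_upto_def)
    then show False
      using C by simp
  qed
  have meets_\<D>: "C \<inter> B \<noteq> {}" if C: "C \<in> \<D> - \<C>" for C
  proof
    assume avoid: "C \<inter> B = {}"
    obtain i x where i: "i \<in> I" "x \<in> L i" and x: "C = cluster (L i) \<omega> x" "real (card C) \<le> l"
      using C by (auto simp: \<D>_def clusters_upto_def)
    have "cluster (L i) \<omega> x \<inter> inner_boundary (L i) = {}"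
      using avoid i(1) unfolding B_def x by blast
    then have "cluster \<Lambda> \<omega> x = C"
      unfolding x(1) using i sub by (intro cluster_eq_if_avoids_inner_boundary) auto
    then have "C \<in> \<C>"
      using i x(2) sub by (auto simp: \<C>_def clusters_upto_def)
    then show False
      using C by simp
  qed
  have finite_B: "finite B"
    using assms(1) finB by (simp add: B_def)
  have card_\<C>: "card (\<C> - \<D>) \<le> card B"
    by (rule card_le_if_disjoint_meets[OF finite_B meets_\<C>]) (use \<C>_disj in auto)
  have card_\<D>: "card (\<D> - \<C>) \<le> card B"
    by (rule card_le_if_disjoint_meets[OF finite_B meets_\<D>]) (use \<D>_disj in auto)
  have card_B: "card B \<le> (\<Sum>i\<in>I. card (inner_boundary (L i)))"
    unfolding B_def using assms(1) by (rule card_UN_le)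
  have "card \<D> = (\<Sum>i\<in>I. card (clusters_upto (L i) \<omega> l))"
    unfolding \<D>_def
  proof (rule card_UN_disjoint)
    show "\<forall>i\<in>I. \<forall>j\<in>I. i \<noteq> j \<longrightarrow> clusters_upto (L i) \<omega> l \<inter> clusters_upto (L j) \<omega> l = {}"
    proof (intro ballI impI equals0I)
      fix i j C
      assume "i \<in> I" "j \<in> I" "i \<noteq> j" "C \<in> clusters_upto (L i) \<omega> l \<inter> clusters_upto (L j) \<omega> l"
      then show False
        using parts_disj[of i j] clusters_upto_nonempty[of C] clusters_upto_subset[of C] by blast
    qed
  qed (use assms in auto)
  then have parts: "(\<Sum>i\<in>I. cluster_count (L i) \<omega> l) = real (card \<D>)"
    by (simp add: cluster_count_eq)
  have "card \<C> \<le> card \<D> + card (\<C> - \<D>)"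
    using fin by (metis card_Un_le card_mono finite_Un le_trans Un_Diff_cancel Un_upper2)
  moreover have "card \<D> \<le> card \<C> + card (\<D> - \<C>)"
    using fin by (metis card_Un_le card_mono finite_Un le_trans Un_Diff_cancel Un_upper2)
  moreover have "cluster_count (\<Union>i\<in>I. L i) \<omega> l = real (card \<C>)"
    by (simp add: cluster_count_eq \<C>_def \<Lambda>_def)
  ultimately show ?thesis
    unfolding parts using card_\<C> card_\<D> card_B
    by (simp only: of_nat_sum[symmetric])
qed

section \<open>Bounds on admissible functions\<close>

lemma sup_norm_le: "(\<And>E. \<bar>F E\<bar> \<le> c) \<Longrightarrow> sup_norm F \<le> c"
  unfolding sup_norm_def by (rule cSUP_least) auto

lemma le_sup_norm:
  assumes "\<And>E. \<bar>F E\<bar> \<le> c"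
  shows "\<bar>F E\<bar> \<le> sup_norm F"
  unfolding sup_norm_def by (rule cSUP_upper) (use assms in \<open>auto simp: bdd_above_def\<close>)

lemma sup_norm_nonneg:
  assumes "\<And>E. \<bar>F E\<bar> \<le> c"
  shows "0 \<le> sup_norm F"
  using le_sup_norm[of F c 0, OF assms] by linarith

lemma rc_bounded_imp_bounded:
  assumes "F \<in> rc_bounded"
  obtains c where "\<And>E. \<bar>F E\<bar> \<le> c"
  using assms by (auto simp: rc_bounded_def bounded_iff)

lemma boundary_termD:
  fixes L :: "nat \<Rightarrow> 'd::finite site set"
  assumes "boundary_term g b D"
  shows boundary_term_nonneg: "finite \<Lambda> \<Longrightarrow> 0 \<le> b \<Lambda>"
    and boundary_term_additive: "1 \<le> n \<Longrightarrow> \<forall>i\<in>{1..n}. finite (L i) \<Longrightarrow> disjoint_family_on L {1..n} \<Longrightarrow>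
      sup_norm (\<lambda>E. g (\<Union>i\<in>{1..n}. L i) \<omega> E - (\<Sum>i\<in>{1..n}. g (L i) \<omega> E)) \<le> (\<Sum>i\<in>{1..n}. b (L i))"
    and boundary_term_le: "finite \<Lambda> \<Longrightarrow> b \<Lambda> \<le> D * real (card \<Lambda>)"
proof -
  note conj = assms[unfolded boundary_term_def]
  show "finite \<Lambda> \<Longrightarrow> 0 \<le> b \<Lambda>"
    by (rule conj[THEN conjunct1, THEN spec, THEN mp])
  show "1 \<le> n \<Longrightarrow> \<forall>i\<in>{1..n}. finite (L i) \<Longrightarrow> disjoint_family_on L {1..n} \<Longrightarrow>
      sup_norm (\<lambda>E. g (\<Union>i\<in>{1..n}. L i) \<omega> E - (\<Sum>i\<in>{1..n}. g (L i) \<omega> E)) \<le> (\<Sum>i\<in>{1..n}. b (L i))"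
    by (rule conj[THEN conjunct2, THEN conjunct1, THEN spec[of _ \<omega>], THEN spec[of _ n],
        THEN spec[of _ L], THEN mp, THEN mp, THEN mp])
  show "finite \<Lambda> \<Longrightarrow> b \<Lambda> \<le> D * real (card \<Lambda>)"
    by (rule conj[THEN conjunct2, THEN conjunct2, THEN conjunct2, THEN conjunct2, THEN conjunct1, THEN spec, THEN mp])
qed

lemma admissibleD:
  assumes "admissible g"
  shows admissible_rc: "finite \<Lambda> \<Longrightarrow> g \<Lambda> \<omega> \<in> rc_bounded"
    and admissible_translate: "finite \<Lambda> \<Longrightarrow> g (translate \<Lambda> z) \<omega> = g \<Lambda> (shift z \<omega>)"
    and admissible_boundary_term: "\<exists>b D. boundary_term g b D"
    and admissible_site_bound: "bdd_above (range (\<lambda>\<omega>. sup_norm (g {0} \<omega>)))"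
proof -
  note conj = assms[unfolded admissible_def]
  show "finite \<Lambda> \<Longrightarrow> g \<Lambda> \<omega> \<in> rc_bounded"
    by (rule conj[THEN conjunct1, THEN spec[of _ \<Lambda>], THEN spec[of _ \<omega>], THEN mp])
  show "finite \<Lambda> \<Longrightarrow> g (translate \<Lambda> z) \<omega> = g \<Lambda> (shift z \<omega>)"
    by (rule conj[THEN conjunct2, THEN conjunct1, THEN spec[of _ \<Lambda>], THEN spec[of _ z],
        THEN spec[of _ \<omega>], THEN mp])
  show "\<exists>b D. boundary_term g b D"
    by (rule conj[THEN conjunct2, THEN conjunct2, THEN conjunct2, THEN conjunct1])
  show "bdd_above (range (\<lambda>\<omega>. sup_norm (g {0} \<omega>)))"
    by (rule conj[THEN conjunct2, THEN conjunct2, THEN conjunct2, THEN conjunct2, THEN conjunct2])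
qed

text \<open>Since \<open>b {} = 0\<close>, additivity for \<open>{} = {} \<union> {}\<close> is exact and reads \<open>g {} = 2 g {}\<close>.\<close>

lemma admissible_empty:
  assumes "admissible g"
  shows "g {} \<omega> E = 0"
proof -
  obtain b D where b: "boundary_term g b D"
    using admissible_boundary_term[OF assms] by blast
  then have "0 \<le> b {}" "b {} \<le> D * real (card ({} :: 'a site set))"
    using boundary_term_nonneg boundary_term_le by blast+
  then have "b {} = 0"
    by simp
  have "sup_norm (\<lambda>E. g (\<Union>i\<in>{1..2::nat}. {}) \<omega> E - (\<Sum>i\<in>{1..2::nat}. g {} \<omega> E)) \<le> (\<Sum>i\<in>{1..2::nat}. b {})"
    by (rule boundary_term_additive[OF b]) (auto simp: disjoint_family_on_def)
  then have "sup_norm (\<lambda>E. - g {} \<omega> E) \<le> 0"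
    using \<open>b {} = 0\<close> by simp
  moreover obtain c where "\<And>E. \<bar>g {} \<omega> E\<bar> \<le> c"
    using rc_bounded_imp_bounded[OF admissible_rc[OF assms, of "{}" \<omega>]] by auto
  then have "\<bar>- g {} \<omega> E\<bar> \<le> sup_norm (\<lambda>E. - g {} \<omega> E)"
    by (intro le_sup_norm[of _ c]) auto
  ultimately show ?thesis
    by linarith
qed

text \<open>Comparing \<open>g \<Lambda>\<close> with the sum of \<open>g\<close> over the sites of \<open>\<Lambda>\<close> gives linear growth.\<close>

lemma admissible_linear_growth:
  assumes g: "admissible g"
  obtains c where "\<And>\<Lambda> \<omega>. finite \<Lambda> \<Longrightarrow> sup_norm (g \<Lambda> \<omega>) \<le> c * real (card \<Lambda>)"
proof -
  obtain b D where b: "boundary_term g b D"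
    using admissible_boundary_term[OF g] by blast
  obtain C where C: "\<And>\<omega>. sup_norm (g {0} \<omega>) \<le> C"
    using admissible_site_bound[OF g] unfolding bdd_above_def by blast
  have single: "\<bar>g {x} \<omega> E\<bar> \<le> C" for x \<omega> E
  proof -
    have "{x} = translate {0} x"
      by (simp add: translate_def)
    moreover have "g (translate {0} x) \<omega> = g {0} (shift x \<omega>)"
      by (rule admissible_translate[OF g]) simp
    ultimately have eq: "g {x} \<omega> = g {0} (shift x \<omega>)"
      by simp
    obtain c where c: "\<And>E. \<bar>g {0} (shift x \<omega>) E\<bar> \<le> c"
      using rc_bounded_imp_bounded[OF admissible_rc[OF g, of "{0}"]] by auto
    have "\<bar>g {x} \<omega> E\<bar> \<le> sup_norm (g {0} (shift x \<omega>))"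
      unfolding eq using c by (rule le_sup_norm)
    then show ?thesis
      using C[of "shift x \<omega>"] by linarith
  qed
  have "sup_norm (g \<Lambda> \<omega>) \<le> (C + D) * real (card \<Lambda>)" if fin: "finite \<Lambda>" for \<Lambda> \<omega>
  proof (cases "\<Lambda> = {}")
    case True
    then show ?thesis
      using admissible_empty[OF g] by (simp add: sup_norm_le)
  next
    case False
    define n where "n = card \<Lambda>"
    have n: "1 \<le> n"
      using fin False by (simp add: n_def Suc_le_eq card_gt_0_iff)
    obtain h where h: "bij_betw h {1..n} \<Lambda>"
      using ex_bij_betw_nat_finite_1[OF fin] by (auto simp: n_def)
    have union: "(\<Union>i\<in>{1..n}. {h i}) = \<Lambda>"
      using bij_betw_imp_surj_on[OF h] by auto
    have "sup_norm (\<lambda>E. g (\<Union>i\<in>{1..n}. {h i}) \<omega> E - (\<Sum>i\<in>{1..n}. g {h i} \<omega> E)) \<le> (\<Sum>i\<in>{1..n}. b {h i})"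
    proof (rule boundary_term_additive[OF b n, of "\<lambda>i. {h i}"])
      show "disjoint_family_on (\<lambda>i. {h i}) {1..n}"
        using bij_betw_imp_inj_on[OF h] unfolding disjoint_family_on_def by (auto dest: inj_onD)
    qed simp
    moreover have "(\<Sum>i\<in>{1..n}. b {h i}) \<le> (\<Sum>i\<in>{1..n}. D)"
    proof (rule sum_mono)
      fix i
      have "b {h i} \<le> D * real (card {h i})"
        by (rule boundary_term_le[OF b]) simp
      then show "b {h i} \<le> D"
        by simp
    qed
    ultimately have close: "sup_norm (\<lambda>E. g \<Lambda> \<omega> E - (\<Sum>i\<in>{1..n}. g {h i} \<omega> E)) \<le> D * real n"
      unfolding union by (simp add: mult.commute)
    obtain c where c: "\<And>E. \<bar>g \<Lambda> \<omega> E\<bar> \<le> c"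
      using rc_bounded_imp_bounded[OF admissible_rc[OF g fin, of \<omega>]] by auto
    have sum: "\<bar>\<Sum>i\<in>{1..n}. g {h i} \<omega> E\<bar> \<le> C * real n" for E
    proof -
      have "\<bar>\<Sum>i\<in>{1..n}. g {h i} \<omega> E\<bar> \<le> (\<Sum>i\<in>{1..n}. \<bar>g {h i} \<omega> E\<bar>)"
        by (rule sum_abs)
      also have "\<dots> \<le> (\<Sum>i\<in>{1..n}. C)"
        by (rule sum_mono) (rule single)
      finally show ?thesis
        by (simp add: mult.commute)
    qed
    show ?thesis
    proof (rule sup_norm_le)
      fix E
      have "\<bar>g \<Lambda> \<omega> E - (\<Sum>i\<in>{1..n}. g {h i} \<omega> E)\<bar>
          \<le> sup_norm (\<lambda>E. g \<Lambda> \<omega> E - (\<Sum>i\<in>{1..n}. g {h i} \<omega> E))"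
      proof (rule le_sup_norm)
        fix E
        show "\<bar>g \<Lambda> \<omega> E - (\<Sum>i\<in>{1..n}. g {h i} \<omega> E)\<bar> \<le> c + C * real n"
          using c[of E] sum[of E] by linarith
      qed
      then have "\<bar>g \<Lambda> \<omega> E\<bar> \<le> D * real n + C * real n"
        using close sum[of E] by linarith
      then show "\<bar>g \<Lambda> \<omega> E\<bar> \<le> (C + D) * real (card \<Lambda>)"
        by (simp add: n_def algebra_simps)
    qed
  qed
  then show ?thesis
    by (rule that)
qed

lemma admissible_abs_le_growth_const:
  assumes g: "admissible g" and fin: "finite \<Lambda>"
  shows "\<bar>g \<Lambda> \<omega> E\<bar> \<le> growth_const g * real (card \<Lambda>)"
proof (cases "\<Lambda> = {}")
  case True
  then show ?thesis
    using admissible_empty[OF g] by simp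
next
  case False
  let ?S = "{sup_norm (g \<Lambda> \<omega>) / real (card \<Lambda>) |\<Lambda> \<omega>. finite \<Lambda> \<and> \<Lambda> \<noteq> {}}"
  obtain c where c: "\<And>\<Lambda> \<omega>. finite \<Lambda> \<Longrightarrow> sup_norm (g \<Lambda> \<omega>) \<le> c * real (card \<Lambda>)"
    using admissible_linear_growth[OF g] by blast
  have pos: "0 < real (card \<Lambda>)" if "finite \<Lambda>" "\<Lambda> \<noteq> {}" for \<Lambda> :: "'a site set"
    using that by (simp add: card_gt_0_iff)
  have "bdd_above ?S"
  proof (rule bdd_aboveI)
    fix x
    assume "x \<in> ?S"
    then obtain \<Lambda> :: "'a site set" and \<omega> where
      "x = sup_norm (g \<Lambda> \<omega>) / real (card \<Lambda>)" "finite \<Lambda>" "\<Lambda> \<noteq> {}"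
      by blast
    then show "x \<le> c"
      using c[of \<Lambda> \<omega>] pos[of \<Lambda>] by (simp add: pos_divide_le_eq)
  qed
  then have "sup_norm (g \<Lambda> \<omega>) / real (card \<Lambda>) \<le> growth_const g"
    unfolding growth_const_def using fin False by (intro cSup_upper) auto
  then have "sup_norm (g \<Lambda> \<omega>) \<le> growth_const g * real (card \<Lambda>)"
    using pos[OF fin False] by (simp add: pos_divide_le_eq)
  moreover obtain c' where "\<And>E. \<bar>g \<Lambda> \<omega> E\<bar> \<le> c'"
    using rc_bounded_imp_bounded[OF admissible_rc[OF g fin, of \<omega>]] by auto
  then have "\<bar>g \<Lambda> \<omega> E\<bar> \<le> sup_norm (g \<Lambda> \<omega>)"
    by (rule le_sup_norm)
  ultimately show ?thesis
    by linarith
qed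

text \<open>Functions that are not integrable have integral \<open>0\<close>, which obeys the bound as well.\<close>

lemma (in prob_space) abs_integral_le:
  fixes h :: "'a \<Rightarrow> real"
  assumes "\<And>x. \<bar>h x\<bar> \<le> c"
  shows "\<bar>\<integral>x. h x \<partial>M\<bar> \<le> c"
proof (cases "integrable M h")
  case True
  then have "\<bar>\<integral>x. h x \<partial>M\<bar> \<le> (\<integral>x. \<bar>h x\<bar> \<partial>M)"
    by (intro integral_abs_bound)
  also have "\<dots> \<le> (\<integral>x. c \<partial>M)"
    using True assms by (intro integral_mono) auto
  finally show ?thesis
    by (simp add: prob_space)
next
  case False
  then show ?thesis
    using assms[of undefined] by (simp add: not_integrable_integral_eq)
qed

text \<open>This makes the supremum over the admissible class an upper bound for each of its members. Since \<open>\<Lambda>\<close> is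
  fixed, the growth constant bounds all integrands at once.\<close>

lemma bdd_above_pairing_difference:
  assumes "prob_space \<nu>1" "prob_space \<nu>2" "finite \<Lambda>"
  shows "bdd_above ((\<lambda>g. sup_norm (\<lambda>E. pairing (g \<Lambda>) \<nu>1 E - pairing (g \<Lambda>) \<nu>2 E) / real N)
    ` admissible_class K D D' r')"
proof (rule bdd_aboveI2)
  fix g :: "'a field"
  assume "g \<in> admissible_class K D D' r'"
  then have g: "admissible g" "growth_const g \<le> K"
    by (auto simp: admissible_class_def)
  have bound: "\<bar>g \<Lambda> \<eta> E\<bar> \<le> K * real (card \<Lambda>)" for \<eta> E
    using admissible_abs_le_growth_const[OF g(1) assms(3), of \<eta> E]
      mult_right_mono[OF g(2), of "real (card \<Lambda>)"] by linarith
  have "sup_norm (\<lambda>E. pairing (g \<Lambda>) \<nu>1 E - pairing (g \<Lambda>) \<nu>2 E) \<le> 2 * (K * real (card \<Lambda>))"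
  proof (rule sup_norm_le)
    fix E
    have "\<bar>pairing (g \<Lambda>) \<nu>1 E\<bar> \<le> K * real (card \<Lambda>)" "\<bar>pairing (g \<Lambda>) \<nu>2 E\<bar> \<le> K * real (card \<Lambda>)"
      unfolding pairing_def using bound assms(1,2) by (auto intro: prob_space.abs_integral_le)
    then show "\<bar>pairing (g \<Lambda>) \<nu>1 E - pairing (g \<Lambda>) \<nu>2 E\<bar> \<le> 2 * (K * real (card \<Lambda>))"
      by linarith
  qed
  then show "sup_norm (\<lambda>E. pairing (g \<Lambda>) \<nu>1 E - pairing (g \<Lambda>) \<nu>2 E) / real N
      \<le> 2 * (K * real (card \<Lambda>)) / real N"
    by (rule divide_right_mono) simp
qed

section \<open>Cluster counting is admissible\<close>

lemma rc_bounded_if_step: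
  assumes step: "\<And>E E'. \<lfloor>E\<rfloor> = \<lfloor>E'\<rfloor> \<Longrightarrow> F E = F E'" and bound: "\<And>E. \<bar>F E\<bar> \<le> c"
  shows "F \<in> rc_bounded"
proof -
  have "continuous (at_right E) F" for E
  proof -
    have "eventually (\<lambda>x. x < of_int \<lfloor>E\<rfloor> + 1) (at_right E)"
      by (rule eventually_at_right_real[THEN eventually_mono, of E "of_int \<lfloor>E\<rfloor> + 1"]) auto
    moreover have "eventually (\<lambda>x. E < x) (at_right E)"
      by (rule eventually_at_right_less)
    ultimately have "eventually (\<lambda>x. F x = F E) (at_right E)"
    proof eventually_elim
      case (elim x)
      then show ?case
        by (intro step floor_unique) linarith+
    qed
    then show ?thesis
      unfolding continuous_within by (rule tendsto_eventually)
  qed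
  moreover have "bounded (range F)"
    using bound by (auto simp: bounded_iff)
  ultimately show ?thesis
    by (simp add: rc_bounded_def)
qed

lemma abs_cluster_count_le_card:
  assumes "finite \<Lambda>"
  shows "\<bar>cluster_count \<Lambda> \<omega> l\<bar> \<le> real (card \<Lambda>)"
  using cluster_count_le_card[OF assms, of \<omega> l] cluster_count_nonneg[of \<Lambda> \<omega> l] by simp

lemma cluster_count_rc_bounded:
  assumes "finite \<Lambda>"
  shows "cluster_count \<Lambda> \<omega> \<in> rc_bounded"
proof (rule rc_bounded_if_step)
  fix E E' :: real
  assume "\<lfloor>E\<rfloor> = \<lfloor>E'\<rfloor>"
  then show "cluster_count \<Lambda> \<omega> E = cluster_count \<Lambda> \<omega> E'"
    by (metis cluster_count_step[OF assms])
next
  show "\<bar>cluster_count \<Lambda> \<omega> E\<bar> \<le> real (card \<Lambda>)" for E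
    by (rule abs_cluster_count_le_card[OF assms])
qed

lemma card_inner_boundary_cube:
  "real (card (inner_boundary (cube n :: 'd::finite site set))) \<le> 2 * real CARD('d) * real n ^ (CARD('d) - 1)"
  unfolding cube_eq_lattice_box by (rule card_inner_boundary_lattice_box) simp

lemma inner_boundary_cube_negligible:
  assumes "strict_mono N"
  shows "(\<lambda>i. real (card (inner_boundary (translate (cube (N i)) (z i) :: 'd::finite site set)))
      / real (card (translate (cube (N i)) (z i) :: 'd site set))) \<longlonglongrightarrow> 0"
proof (rule tendsto_sandwich[where f = "\<lambda>_. 0"])
  have "filterlim (\<lambda>i. real (N i)) at_top sequentially"
    by (rule filterlim_compose[OF filterlim_real_sequentially filterlim_subseq[OF assms]])
  then show "(\<lambda>i. 2 * real CARD('d) / real (N i)) \<longlonglongrightarrow> 0"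
    by (rule real_tendsto_divide_at_top[OF tendsto_const])
  show "\<forall>\<^sub>F i in sequentially. real (card (inner_boundary (translate (cube (N i)) (z i) :: 'd site set)))
      / real (card (translate (cube (N i)) (z i) :: 'd site set)) \<le> 2 * real CARD('d) / real (N i)"
  proof (rule always_eventually, rule allI)
    fix i
    have "real (card (inner_boundary (translate (cube (N i)) (z i) :: 'd site set)))
        / real (card (translate (cube (N i)) (z i) :: 'd site set))
        \<le> (2 * real CARD('d) * real (N i) ^ (CARD('d) - 1)) / real (N i) ^ CARD('d)"
      using card_inner_boundary_cube[of "N i", where 'd = 'd]
      by (simp add: inner_boundary_translate card_cube divide_right_mono)
    also have "\<dots> \<le> 2 * real CARD('d) / real (N i)"
      by (cases "N i = 0") (auto simp: power_diff power_0_left field_simps)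
    finally show "real (card (inner_boundary (translate (cube (N i)) (z i) :: 'd site set)))
        / real (card (translate (cube (N i)) (z i) :: 'd site set)) \<le> 2 * real CARD('d) / real (N i)" .
  qed
qed auto

lemma boundary_term_cluster_count:
  "boundary_term (cluster_count :: 'd::finite field) (\<lambda>\<Lambda>. real (card (inner_boundary \<Lambda>))) 1"
  unfolding boundary_term_def
proof (intro conjI allI impI)
  fix \<omega> and n :: nat and L :: "nat \<Rightarrow> 'd site set"
  assume "\<forall>i\<in>{1..n}. finite (L i)" "disjoint_family_on L {1..n}"
  then show "sup_norm (\<lambda>E. cluster_count (\<Union>i\<in>{1..n}. L i) \<omega> E - (\<Sum>i\<in>{1..n}. cluster_count (L i) \<omega> E))
      \<le> (\<Sum>i\<in>{1..n}. real (card (inner_boundary (L i))))"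
    by (intro sup_norm_le cluster_count_almost_additive) auto
next
  fix \<Lambda> :: "'d site set"
  assume "finite \<Lambda>"
  then show "real (card (inner_boundary \<Lambda>)) \<le> 1 * real (card \<Lambda>)"
    using inner_boundary_subset[of \<Lambda>] by (simp add: card_mono)
next
  fix N :: "nat \<Rightarrow> nat" and z :: "nat \<Rightarrow> 'd site"
  assume "strict_mono N"
  then show "(\<lambda>i. real (card (inner_boundary (translate (cube (N i)) (z i))))
      / real (card (translate (cube (N i)) (z i)))) \<longlonglongrightarrow> 0"
    by (rule inner_boundary_cube_negligible)
qed (auto simp: inner_boundary_translate)

lemma admissible_cluster_count: "admissible (cluster_count :: 'd::finite field)"
  unfolding admissible_def
proof (intro conjI allI impI)
  show "\<exists>b D. boundary_term (cluster_count :: 'd field) b D"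
    using boundary_term_cluster_count by blast
  \<comment> \<open>Opening any site can only merge clusters, so the sign is \<open>-1\<close> at every site.\<close>
  show "\<exists>s :: 'd site \<Rightarrow> int. (\<forall>z. s z \<in> {-1, 1}) \<and>
      (\<forall>\<Lambda> \<omega> \<omega>' z E. finite \<Lambda> \<longrightarrow> z \<in> \<Lambda> \<longrightarrow>
         restrict \<omega> (\<Lambda> - {z}) = restrict \<omega>' (\<Lambda> - {z}) \<longrightarrow> \<omega> z \<le> \<omega>' z \<longrightarrow>
         (s z = 1 \<longrightarrow> cluster_count \<Lambda> \<omega> E \<le> cluster_count \<Lambda> \<omega>' E) \<and>
         (s z = -1 \<longrightarrow> cluster_count \<Lambda> \<omega>' E \<le> cluster_count \<Lambda> \<omega> E))"
  proof (rule exI[of _ "\<lambda>_. -1"], intro conjI allI impI)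
    fix \<Lambda> :: "'d site set" and \<omega> \<omega>' :: "'d config" and z E
    assume fin: "finite \<Lambda>" and eq: "restrict \<omega> (\<Lambda> - {z}) = restrict \<omega>' (\<Lambda> - {z})" and "\<omega> z \<le> \<omega>' z"
    have "\<omega> x \<le> \<omega>' x" if "x \<in> \<Lambda>" for x
    proof (cases "x = z")
      case False
      then show ?thesis
        using fun_cong[OF eq, of x] that by simp
    qed (use \<open>\<omega> z \<le> \<omega>' z\<close> in simp)
    then show "cluster_count \<Lambda> \<omega>' E \<le> cluster_count \<Lambda> \<omega> E"
      by (rule cluster_count_antimono[OF fin])
  qed auto
  have "sup_norm (cluster_count {0 :: 'd site} \<omega>) \<le> 1" for \<omega>
    using abs_cluster_count_le_card[of "{0 :: 'd site}" \<omega>] by (intro sup_norm_le) simp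
  then show "bdd_above (range (\<lambda>\<omega>. sup_norm (cluster_count {0 :: 'd site} \<omega>)))"
    by (intro bdd_aboveI2)
qed (auto simp: cluster_count_rc_bounded cluster_count_translate intro: cluster_count_local)

lemma growth_const_cluster_count: "growth_const (cluster_count :: 'd::finite field) \<le> 1"
  unfolding growth_const_def
proof (rule cSup_least)
  show "{sup_norm (cluster_count \<Lambda> \<omega>) / real (card \<Lambda>) |(\<Lambda> :: 'd site set) \<omega>. finite \<Lambda> \<and> \<Lambda> \<noteq> {}} \<noteq> {}"
    by (auto intro!: exI[of _ "{0}"])
next
  fix x
  assume "x \<in> {sup_norm (cluster_count \<Lambda> \<omega>) / real (card \<Lambda>) |(\<Lambda> :: 'd site set) \<omega>. finite \<Lambda> \<and> \<Lambda> \<noteq> {}}"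
  then obtain \<Lambda> :: "'d site set" and \<omega> where
    x: "x = sup_norm (cluster_count \<Lambda> \<omega>) / real (card \<Lambda>)" and \<Lambda>: "finite \<Lambda>" "\<Lambda> \<noteq> {}"
    by blast
  have "sup_norm (cluster_count \<Lambda> \<omega>) \<le> real (card \<Lambda>)"
    using \<Lambda>(1) by (intro sup_norm_le abs_cluster_count_le_card)
  then show "x \<le> 1"
    using \<Lambda> by (simp add: x card_gt_0_iff divide_le_eq_1)
qed

lemma cluster_count_in_admissible_class:
  assumes "1 \<le> K" "1 \<le> D" "1 \<le> D'" "1 \<le> r'"
  shows "(cluster_count :: 'd::finite field) \<in> admissible_class K D D' r'"
proof -
  have "proper_boundary (\<lambda>\<Lambda> :: 'd site set. real (card (inner_boundary \<Lambda>))) 1 1"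
    unfolding proper_boundary_def
    using card_inner_boundary_le_boundary_layer[of "translate (cube _) _ :: 'd site set"] by simp
  moreover have "growth_const (cluster_count :: 'd field) \<le> K"
    using growth_const_cluster_count assms(1) by (rule order_trans)
  ultimately show ?thesis
    unfolding admissible_class_def
    using admissible_cluster_count boundary_term_cluster_count assms(2-4) by blast
qed

section \<open>A law of large numbers for arrays of independent events\<close>

lemma (in prob_space) indep_vars_indicator:
  assumes "indep_events A I"
  shows "indep_vars (\<lambda>_. borel) (\<lambda>i. indicator (A i) :: 'a \<Rightarrow> real) I"
proof -
  have A: "A i \<in> events" if "i \<in> I" for i
    using assms that by (auto simp: indep_events_def)
  have "indep_sets (\<lambda>i. sigma_sets (space M) {A i}) I"
    using assms unfolding indep_events_def_alt by (rule indep_sets_sigma) (simp add: Int_stable_def)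
  then have "indep_sets (\<lambda>i. {(indicator (A i) :: 'a \<Rightarrow> real) -` B \<inter> space M |B. B \<in> sets borel}) I"
  proof (rule indep_sets_mono_sets)
    fix i
    assume i: "i \<in> I"
    show "{(indicator (A i) :: 'a \<Rightarrow> real) -` B \<inter> space M |B. B \<in> sets borel} \<subseteq> sigma_sets (space M) {A i}"
    proof clarify
      fix B :: "real set"
      have sub: "A i \<subseteq> space M"
        using A[OF i] by (rule sets.sets_into_space)
      have "(indicator (A i) :: 'a \<Rightarrow> real) -` B \<inter> space M =
          (if 1 \<in> B then if 0 \<in> B then space M else A i else if 0 \<in> B then space M - A i else {})"
        using sub by (auto simp: indicator_def of_bool_def split: if_splits)
      also have "\<dots> \<in> sigma_sets (space M) {A i}"
        by (auto intro: sigma_sets_top sigma_sets.Empty sigma_sets.Basic sigma_sets.Compl)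
      finally show "(indicator (A i) :: 'a \<Rightarrow> real) -` B \<inter> space M \<in> sigma_sets (space M) {A i}" .
    qed
  qed
  then show ?thesis
    unfolding indep_vars_def2 using A by auto
qed

text \<open>Hoeffding's inequality bounds the probability of a deviation by \<open>\<epsilon>\<close> geometrically in \<open>q\<close>, whence
  the Borel--Cantelli lemma applies.\<close>

lemma (in prob_space) frequencies_converge:
  assumes fin: "\<And>q. finite (T q)" and size: "\<And>q. q \<le> card (T q)"
    and indep: "\<And>q. indep_events A (T q)"
    and prob_A: "\<And>q t. t \<in> T q \<Longrightarrow> prob (A t) = p"
  shows "AE \<omega> in M. (\<lambda>q. (\<Sum>t\<in>T q. indicator (A t) \<omega>) / real (card (T q))) \<longlonglongrightarrow> p"
proof -
  define S :: "nat \<Rightarrow> 'a \<Rightarrow> real" where "S q \<omega> = (\<Sum>t\<in>T q. indicator (A t) \<omega>)" for q \<omega>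
  have A: "A t \<in> events" if "t \<in> T q" for t q
    using indep[of q] that by (auto simp: indep_events_def)
  have meas [measurable]: "S q \<in> borel_measurable M" for q
    unfolding S_def using A by measurable
  have rare: "AE \<omega> in M. eventually (\<lambda>q. \<bar>S q \<omega> / real (card (T q)) - p\<bar> < \<epsilon>) sequentially"
    if "0 < \<epsilon>" for \<epsilon>
  proof -
    define B where "B q = {\<omega> \<in> space M. \<epsilon> * real (card (T q)) \<le> \<bar>S q \<omega> - real (card (T q)) * p\<bar>}" for q
    have B: "B q \<in> events" for q
      unfolding B_def by measurable
    have bound: "prob (B q) \<le> 2 * exp (- 2 * \<epsilon>\<^sup>2) ^ q" for q
    proof (cases "q = 0")
      case True
      then show ?thesis
        using prob_le_1[of "B 0"] by (simp del: prob_le_1)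
    next
      case False
      define N where "N = card (T q)"
      have N: "q \<le> N" "0 < N"
        using size[of q] False by (auto simp: N_def)
      interpret H: Hoeffding_ineq M "T q" "\<lambda>t. indicator (A t)" "\<lambda>_. 0" "\<lambda>_. 1"
          "\<Sum>t\<in>T q. expectation (indicator (A t))"
        by unfold_locales (auto simp: fin indep_vars_indicator[OF indep] indicator_def)
      have \<mu>: "(\<Sum>t\<in>T q. expectation (indicator (A t))) = real N * p"
        using A prob_A by (simp add: N_def)
      have "prob {\<omega> \<in> space M. \<epsilon> * real N \<le> \<bar>(\<Sum>t\<in>T q. indicator (A t) \<omega>) -
            (\<Sum>t\<in>T q. expectation (indicator (A t)))\<bar>}
          \<le> 2 * exp (- 2 * (\<epsilon> * real N)\<^sup>2 / (\<Sum>t\<in>T q. (1 - 0)\<^sup>2))"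
        using \<open>0 < \<epsilon>\<close> N by (intro H.Hoeffding_ineq_abs_ge) (auto simp: N_def)
      then have "prob (B q) \<le> 2 * exp (- 2 * (\<epsilon> * real N)\<^sup>2 / real N)"
        unfolding B_def S_def \<mu> by (simp add: N_def)
      also have "- 2 * (\<epsilon> * real N)\<^sup>2 / real N = real N * (- 2 * \<epsilon>\<^sup>2)"
        using N by (simp add: power2_eq_square)
      also have "2 * exp (real N * (- 2 * \<epsilon>\<^sup>2)) \<le> 2 * exp (real q * (- 2 * \<epsilon>\<^sup>2))"
        using mult_right_mono_neg[of "real q" "real N" "- 2 * \<epsilon>\<^sup>2"] N by simp
      finally show ?thesis
        by (simp only: exp_of_nat_mult)
    qed
    have "summable (\<lambda>q. 2 * exp (- 2 * \<epsilon>\<^sup>2) ^ q)"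
      using \<open>0 < \<epsilon>\<close> by (intro summable_mult summable_geometric) simp
    then have "summable (\<lambda>q. prob (B q))"
      by (rule summable_comparison_test') (use bound in auto)
    then have "AE \<omega> in M. eventually (\<lambda>q. \<omega> \<in> space M - B q) sequentially"
      by (intro borel_cantelli_AE1 B) (auto simp: emeasure_eq_measure)
    then show ?thesis
    proof eventually_elim
      case (elim \<omega>)
      then show ?case
        using eventually_gt_at_top[of 0]
      proof eventually_elim
        case (elim q)
        have "0 < real (card (T q))"
          using size[of q] elim(2) by simp
        moreover have "\<bar>S q \<omega> - real (card (T q)) * p\<bar> < \<epsilon> * real (card (T q))"
          using elim(1) by (auto simp: B_def)
        moreover have "S q \<omega> / real (card (T q)) - p = (S q \<omega> - real (card (T q)) * p) / real (card (T q))"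
          using calculation(1) by (simp add: field_simps)
        ultimately show ?case
          by (simp add: abs_divide pos_divide_less_eq)
      qed
    qed
  qed
  have "AE \<omega> in M. \<forall>k. eventually (\<lambda>q. \<bar>S q \<omega> / real (card (T q)) - p\<bar> < inverse (real (Suc k))) sequentially"
    unfolding AE_all_countable by (intro allI rare) simp
  then show ?thesis
  proof eventually_elim
    case (elim \<omega>)
    show ?case
    proof (rule tendstoI)
      fix e :: real
      assume "0 < e"
      then obtain k where k: "inverse (real (Suc k)) < e"
        using reals_Archimedean by blast
      show "\<forall>\<^sub>F q in sequentially. dist ((\<Sum>t\<in>T q. indicator (A t) \<omega>) / real (card (T q))) p < e"
        using elim[rule_format, of k]
        by eventually_elim (use k in \<open>auto simp: dist_real_def S_def\<close>)
    qed
  qed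
qed

section \<open>Patterns in distant tiles are independent\<close>

lemma restrict_eq_iff: "restrict \<omega> \<Lambda> = restrict \<xi> \<Lambda> \<longleftrightarrow> (\<forall>x\<in>\<Lambda>. \<omega> x = \<xi> x)"
  by (metis restrict_apply' restrict_ext)

definition cylinder :: "'d::finite config \<Rightarrow> 'd site set \<Rightarrow> 'd config set" where
  "cylinder \<xi> \<Lambda> = {\<omega>. \<forall>x\<in>\<Lambda>. \<omega> x = \<xi> x}"

locale finite_range_law = prob_space P for P :: "'d::finite config measure" +
  fixes \<mu> :: "'d site \<Rightarrow> bool measure" and r :: nat
  assumes sets_P: "sets P = sets (config_space UNIV)"
    and M1: "M1 P" and M2: "M2 P \<mu>" and M3: "M3 P \<mu> r"
begin

lemma space_P: "space P = UNIV"
  using sets_eq_imp_space_eq[OF sets_P] by (simp add: config_space_def space_PiM)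

lemma measurable_site [measurable]: "(\<lambda>\<omega>. \<omega> x) \<in> P \<rightarrow>\<^sub>M count_space UNIV"
  unfolding measurable_cong_sets[OF sets_P refl] config_space_def
  by (rule measurable_component_singleton) simp

lemma measurable_restriction: "(\<lambda>\<omega>. restrict \<omega> \<Lambda>) \<in> P \<rightarrow>\<^sub>M config_space \<Lambda>"
  unfolding config_space_def by (rule measurable_restrict) simp

lemma measurable_shift: "shift z \<in> P \<rightarrow>\<^sub>M P"
proof -
  have "(\<lambda>\<omega>. \<lambda>x\<in>UNIV. \<omega> (x + z)) \<in> P \<rightarrow>\<^sub>M config_space UNIV"
    unfolding config_space_def by (rule measurable_restrict) simp
  then show ?thesis
    unfolding measurable_cong_sets[OF refl sets_P] by (simp add: shift_def[abs_def] restrict_UNIV)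
qed

lemma cylinder_measurable [measurable]: "finite \<Lambda> \<Longrightarrow> cylinder \<xi> \<Lambda> \<in> sets P"
proof -
  assume "finite \<Lambda>"
  then have "{\<omega> \<in> space P. \<forall>x\<in>\<Lambda>. \<omega> x = \<xi> x} \<in> sets P"
    by (intro sets.sets_Collect_finite_All) auto
  then show ?thesis
    by (simp add: cylinder_def space_P)
qed

text \<open>On finitely many sites all measures are atomic, so the abstract density becomes a ratio of weights at
  each atom. This is what turns an identity of densities into one of probabilities.\<close>

lemma emeasure_cylinder:
  assumes fin: "finite \<Lambda>"
  shows "emeasure P (cylinder \<xi> \<Lambda>) =
    marginal_density P \<mu> \<Lambda> (restrict \<xi> \<Lambda>) * (\<Prod>z\<in>\<Lambda>. emeasure (\<mu> z) {\<xi> z})"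
proof -
  let ?M = "\<Pi>\<^sub>M z\<in>\<Lambda>. \<mu> z" and ?\<eta> = "restrict \<xi> \<Lambda>"
  have sets_\<mu>: "sets (\<mu> z) = Pow UNIV" for z
    using M2 by (simp add: M2_def)
  interpret product_sigma_finite \<mu>
    using M2 by (simp add: M2_def product_sigma_finite_def)
  interpret M: sigma_finite_measure ?M
    using fin by (rule sigma_finite)
  have sets_M: "sets (config_space \<Lambda>) = sets ?M"
    unfolding config_space_def by (rule sets_PiM_cong) (simp_all add: sets_\<mu>)
  have singleton: "(\<Pi>\<^sub>E z\<in>\<Lambda>. {?\<eta> z}) = {?\<eta>}"
    by (intro PiE_singleton restrict_extensional)
  have \<eta>: "{?\<eta>} \<in> sets ?M"
    unfolding singleton[symmetric] using fin by (intro sets_PiM_I_finite) (simp_all add: sets_\<mu>)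
  have "density ?M (marginal_density P \<mu> \<Lambda>) = marginal P \<Lambda>"
    unfolding marginal_density_def
    using M2 fin by (intro M.density_RN_deriv) (simp_all add: M2_def marginal_def sets_M)
  then have "emeasure (marginal P \<Lambda>) {?\<eta>} = emeasure (density ?M (marginal_density P \<mu> \<Lambda>)) {?\<eta>}"
    by simp
  also have "\<dots> = (\<integral>\<^sup>+x. marginal_density P \<mu> \<Lambda> x * indicator {?\<eta>} x \<partial>?M)"
    by (rule emeasure_density) (use \<eta> in \<open>simp_all add: marginal_density_def\<close>)
  also have "\<dots> = marginal_density P \<mu> \<Lambda> ?\<eta> * emeasure ?M {?\<eta>}"
    using \<eta> by (rule nn_integral_indicator_singleton)
  also have "emeasure ?M {?\<eta>} = (\<Prod>z\<in>\<Lambda>. emeasure (\<mu> z) {?\<eta> z})"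
    unfolding singleton[symmetric] using fin by (intro emeasure_PiM) (simp_all add: sets_\<mu>)
  also have "\<dots> = (\<Prod>z\<in>\<Lambda>. emeasure (\<mu> z) {\<xi> z})"
    by (rule prod.cong) simp_all
  finally have "emeasure (marginal P \<Lambda>) {?\<eta>} =
      marginal_density P \<mu> \<Lambda> ?\<eta> * (\<Prod>z\<in>\<Lambda>. emeasure (\<mu> z) {\<xi> z})" .
  moreover have "emeasure (marginal P \<Lambda>) {?\<eta>} = emeasure P ((\<lambda>\<omega>. restrict \<omega> \<Lambda>) -` {?\<eta>} \<inter> space P)"
    unfolding marginal_def by (rule emeasure_distr) (use \<eta> in \<open>simp_all add: sets_M measurable_restriction\<close>)
  moreover have "(\<lambda>\<omega>. restrict \<omega> \<Lambda>) -` {?\<eta>} \<inter> space P = cylinder \<xi> \<Lambda>"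
    by (auto simp: cylinder_def space_P restrict_eq_iff)
  ultimately show ?thesis
    by simp
qed

text \<open>If the reference measure charges the pattern, then the almost everywhere factorization of the densities
  holds at this pattern; otherwise both sides vanish.\<close>

lemma emeasure_cylinder_Union:
  assumes "finite J" "J \<noteq> {}" and L: "\<And>j. j \<in> J \<Longrightarrow> finite (L j) \<and> L j \<noteq> {}"
    and far: "\<And>i j. i \<in> J \<Longrightarrow> j \<in> J \<Longrightarrow> i \<noteq> j \<Longrightarrow> enat r < set_dist (L i) (L j)"
    and disj: "disjoint_family_on L J"
  shows "emeasure P (cylinder \<xi> (\<Union>j\<in>J. L j)) = (\<Prod>j\<in>J. emeasure P (cylinder \<xi> (L j)))"
proof -
  let ?\<Lambda> = "\<Union>j\<in>J. L j" and ?w = "\<lambda>z. emeasure (\<mu> z) {\<xi> z}"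
  let ?M = "\<Pi>\<^sub>M z\<in>?\<Lambda>. \<mu> z" and ?\<eta> = "restrict \<xi> (\<Union>j\<in>J. L j)"
  let ?\<rho> = "marginal_density P \<mu>"
  have fin: "finite ?\<Lambda>"
    using assms(1) L by auto
  have cyl: "emeasure P (cylinder \<xi> ?\<Lambda>) = ?\<rho> ?\<Lambda> ?\<eta> * (\<Prod>z\<in>?\<Lambda>. ?w z)"
    by (rule emeasure_cylinder[OF fin])
  have cyl_j: "emeasure P (cylinder \<xi> (L j)) = ?\<rho> (L j) (restrict \<xi> (L j)) * (\<Prod>z\<in>L j. ?w z)"
    if "j \<in> J" for j
    using L[OF that] by (intro emeasure_cylinder) auto
  show ?thesis
  proof (cases "\<exists>z\<in>?\<Lambda>. ?w z = 0")
    case True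
    then obtain z j where z: "j \<in> J" "z \<in> L j" "?w z = 0"
      by auto
    have "(\<Prod>z\<in>L j. ?w z) = 0" "(\<Prod>z\<in>?\<Lambda>. ?w z) = 0"
      using z L[OF z(1)] fin by (auto intro!: prod_zero)
    moreover have "(\<Prod>j\<in>J. emeasure P (cylinder \<xi> (L j))) = 0"
      using assms(1) z(1) cyl_j[OF z(1)] calculation(1)
      by (intro prod_zero) (auto simp only: mult_zero_right)
    ultimately show ?thesis
      by (simp only: cyl mult_zero_right)
  next
    case False
    interpret product_sigma_finite \<mu>
      using M2 by (simp add: M2_def product_sigma_finite_def)
    have sets_\<mu>: "sets (\<mu> z) = Pow UNIV" for z
      using M2 by (simp add: M2_def)
    have singleton: "(\<Pi>\<^sub>E z\<in>?\<Lambda>. {?\<eta> z}) = {?\<eta>}"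
      by (intro PiE_singleton restrict_extensional)
    have weight: "emeasure ?M {?\<eta>} = (\<Prod>z\<in>?\<Lambda>. emeasure (\<mu> z) {?\<eta> z})"
      unfolding singleton[symmetric] using fin by (intro emeasure_PiM) (simp_all add: sets_\<mu>)
    have "emeasure (\<mu> z) {?\<eta> z} \<noteq> 0" if "z \<in> ?\<Lambda>" for z
      using False that by auto
    then have pos: "emeasure ?M {?\<eta>} \<noteq> 0"
      unfolding weight using fin by (induction "?\<Lambda>" rule: infinite_finite_induct) auto
    have "AE \<zeta> in ?M. ?\<rho> ?\<Lambda> \<zeta> = (\<Prod>j\<in>J. ?\<rho> (L j) (restrict \<zeta> (L j)))"
    proof -
      define n where "n = card J"
      obtain h where h: "bij_betw h {1..n} J"
        using ex_bij_betw_nat_finite_1[OF assms(1)] by (auto simp: n_def)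
      have n: "1 \<le> n"
        using assms(1,2) by (simp add: n_def Suc_le_eq card_gt_0_iff)
      have hJ: "h i \<in> J" if "i \<in> {1..n}" for i
        using h that by (auto dest: bij_betwE)
      have inj: "h i \<noteq> h j" if "i \<in> {1..n}" "j \<in> {1..n}" "i \<noteq> j" for i j
        using bij_betw_imp_inj_on[OF h] that by (auto dest: inj_onD)
      have union: "(\<Union>j\<in>{1..n}. L (h j)) = ?\<Lambda>"
        using bij_betw_imp_surj_on[OF h] by (metis image_image)
      have prod: "(\<Prod>j\<in>{1..n}. ?\<rho> (L (h j)) (restrict \<zeta> (L (h j)))) = (\<Prod>j\<in>J. ?\<rho> (L j) (restrict \<zeta> (L j)))"
        for \<zeta>
        using h by (rule prod.reindex_bij_betw)
      have "AE \<zeta> in (\<Pi>\<^sub>M z\<in>(\<Union>j\<in>{1..n}. L (h j)). \<mu> z).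
          ?\<rho> (\<Union>j\<in>{1..n}. L (h j)) \<zeta> = (\<Prod>j\<in>{1..n}. ?\<rho> (L (h j)) (restrict \<zeta> (L (h j))))"
        using n hJ inj L far
        by (intro M3[unfolded M3_def, THEN spec[of _ n], THEN spec[of _ "\<lambda>j. L (h j)"], THEN mp, THEN mp, THEN mp])
          auto
      then show ?thesis
        unfolding union prod .
    qed
    then obtain N where N: "{\<zeta> \<in> space ?M. \<not> ?\<rho> ?\<Lambda> \<zeta> = (\<Prod>j\<in>J. ?\<rho> (L j) (restrict \<zeta> (L j)))} \<subseteq> N"
        "N \<in> sets ?M" "emeasure ?M N = 0"
      by (rule AE_E)
    have "?\<eta> \<notin> N"
    proof
      assume "?\<eta> \<in> N"
      then have "emeasure ?M {?\<eta>} \<le> emeasure ?M N"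
        by (intro emeasure_mono N) simp
      then show False
        using pos N(3) by simp
    qed
    moreover have "?\<eta> \<in> space ?M"
    proof -
      have "space (\<mu> z) = UNIV" for z
        using sets_eq_imp_space_eq[of "\<mu> z" "count_space UNIV"] sets_\<mu> by simp
      then show ?thesis
        by (simp add: space_PiM)
    qed
    ultimately have "?\<rho> ?\<Lambda> ?\<eta> = (\<Prod>j\<in>J. ?\<rho> (L j) (restrict ?\<eta> (L j)))"
      using N(1) by blast
    also have "\<dots> = (\<Prod>j\<in>J. ?\<rho> (L j) (restrict \<xi> (L j)))"
    proof (rule prod.cong[OF refl])
      fix j
      assume "j \<in> J"
      then have "?\<Lambda> \<inter> L j = L j"
        by auto
      then show "?\<rho> (L j) (restrict ?\<eta> (L j)) = ?\<rho> (L j) (restrict \<xi> (L j))"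
        by simp
    qed
    moreover have "(\<Prod>z\<in>?\<Lambda>. ?w z) = (\<Prod>j\<in>J. \<Prod>z\<in>L j. ?w z)"
      using assms(1) L disj by (intro prod.UNION_disjoint) (auto simp: disjoint_family_on_def)
    ultimately have "emeasure P (cylinder \<xi> ?\<Lambda>) =
        (\<Prod>j\<in>J. ?\<rho> (L j) (restrict \<xi> (L j)) * (\<Prod>z\<in>L j. ?w z))"
      by (simp add: cyl prod.distrib)
    then show ?thesis
      using cyl_j by simp
  qed
qed

lemma prob_shift: "B \<in> sets P \<Longrightarrow> prob (shift t -` B) = prob B"
proof -
  assume B: "B \<in> sets P"
  have "prob B = measure (distr P P (shift t)) B"
    using M1 by (simp add: M1_def)
  also have "\<dots> = prob (shift t -` B)"
    using measure_distr[OF measurable_shift B] by (simp add: space_P)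
  finally show ?thesis
    by simp
qed

text \<open>Patterns in several shrunken tiles form one pattern on sets that are further than \<open>r\<close> apart, to which the
  factorization applies. These sets are nonempty because of \<open>2 * r < m\<close>.\<close>

lemma indep_events_tiles:
  assumes m: "1 \<le> m" "2 * r < m"
  shows "indep_events (\<lambda>t. shift t -` cylinder \<xi> (inner_part r (cube m))) (tiling m n :: 'd site set)"
proof -
  let ?\<Lambda> = "inner_part r (cube m) :: 'd site set"
  \<comment> \<open>The \<open>m\<close>-periodic continuation of the pattern prescribes the colours in all tiles at once.\<close>
  define \<zeta> where "\<zeta> y = \<xi> (\<chi> i. y $ i mod int m)" for y
  have pattern: "shift t -` cylinder \<xi> ?\<Lambda> = cylinder \<zeta> (translate ?\<Lambda> t)" if t: "t \<in> tiling m n" for t :: "'d site"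
  proof -
    have "\<zeta> (x + t) = \<xi> x" if x: "x \<in> ?\<Lambda>" for x
    proof -
      obtain k where k: "t = int m *s k"
        using t by (auto simp: tiling_eq[OF m(1)])
      have "0 \<le> x $ i \<and> x $ i < int m" for i
        using x inner_part_subset[of r "cube m"] by (auto simp: cube_def)
      then have "(\<chi> i. (x + t) $ i mod int m) = x"
        by (simp add: k vec_eq_iff)
      then show ?thesis
        by (simp add: \<zeta>_def)
    qed
    then show ?thesis
      by (auto simp: cylinder_def shift_def translate_def)
  qed
  have fin: "finite (translate ?\<Lambda> t)" for t
    by simp
  have nonempty: "translate ?\<Lambda> t \<noteq> {}" for t
  proof -
    have "(\<chi> i. int r) \<in> ?\<Lambda>"
      using m by (simp add: inner_part_cube lattice_box_def)
    then show ?thesis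
      by (auto simp: translate_def)
  qed
  show ?thesis
  proof (rule indep_eventsI)
    fix t :: "'d site"
    assume "t \<in> tiling m n"
    then show "shift t -` cylinder \<xi> ?\<Lambda> \<in> sets P"
      using pattern fin cylinder_measurable by metis
  next
    fix J :: "'d site set"
    assume J: "J \<subseteq> tiling m n" "finite J" "J \<noteq> {}"
    have "(\<Inter>t\<in>J. shift t -` cylinder \<xi> ?\<Lambda>) = (\<Inter>t\<in>J. cylinder \<zeta> (translate ?\<Lambda> t))"
      using J pattern by (intro INF_cong) auto
    also have "\<dots> = cylinder \<zeta> (\<Union>t\<in>J. translate ?\<Lambda> t)"
      by (auto simp: cylinder_def)
    finally have "emeasure P (\<Inter>t\<in>J. shift t -` cylinder \<xi> ?\<Lambda>)
        = emeasure P (cylinder \<zeta> (\<Union>t\<in>J. translate ?\<Lambda> t))"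
      by simp
    also have "\<dots> = (\<Prod>t\<in>J. emeasure P (cylinder \<zeta> (translate ?\<Lambda> t)))"
    proof (rule emeasure_cylinder_Union[OF J(2,3)])
      fix s t
      assume st: "s \<in> J" "t \<in> J" "s \<noteq> t"
      then have "\<not> set_dist (translate ?\<Lambda> s) (translate ?\<Lambda> t) \<le> enat r"
        using tiles_far_apart[OF m(1), of s n t] J(1) unfolding set_dist_le_iff by fastforce
      then show "enat r < set_dist (translate ?\<Lambda> s) (translate ?\<Lambda> t)"
        by simp
    next
      show "disjoint_family_on (translate ?\<Lambda>) J"
        using tiles_disjoint[OF m(1)] J(1) by (rule disjoint_family_on_mono[rotated])
    qed (use nonempty in auto)
    also have "\<dots> = (\<Prod>t\<in>J. emeasure P (shift t -` cylinder \<xi> ?\<Lambda>))"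
      using J pattern by (intro prod.cong) auto
    finally show "prob (\<Inter>t\<in>J. shift t -` cylinder \<xi> ?\<Lambda>) = (\<Prod>t\<in>J. prob (shift t -` cylinder \<xi> ?\<Lambda>))"
      by (simp add: emeasure_eq_measure prod_ennreal prod_nonneg)
  qed
qed

lemma filterlim_div_at_top:
  assumes "1 \<le> (m :: nat)"
  shows "filterlim (\<lambda>n. n div m) at_top sequentially"
  unfolding filterlim_at_top
proof
  fix Z :: nat
  show "eventually (\<lambda>n. Z \<le> n div m) sequentially"
    using eventually_ge_at_top[of "Z * m"]
    by eventually_elim (use assms in \<open>simp add: less_eq_div_iff_mult_less_eq\<close>)
qed

lemma pattern_frequencies_converge:
  assumes m: "1 \<le> m" "2 * r < m"
  shows "AE \<omega> in P. (\<lambda>n. (\<Sum>t\<in>tiling m n. indicator (cylinder \<xi> (inner_part r (cube m))) (shift t \<omega>))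
      / real (card (tiling m n :: 'd site set))) \<longlonglongrightarrow> prob (cylinder \<xi> (inner_part r (cube m)))"
proof -
  let ?\<Lambda> = "inner_part r (cube m) :: 'd site set"
  define T :: "nat \<Rightarrow> 'd site set" where "T q = tiling m (m * q)" for q
  have T: "tiling m n = T (n div m)" for n
    using m by (simp add: T_def tiling_eq)
  have "AE \<omega> in P. (\<lambda>q. (\<Sum>t\<in>T q. indicator (shift t -` cylinder \<xi> ?\<Lambda>) \<omega>) / real (card (T q)))
      \<longlonglongrightarrow> prob (cylinder \<xi> ?\<Lambda>)"
  proof (rule frequencies_converge)
    show "q \<le> card (T q)" for q
    proof (cases "q = 0")
      case False
      then show ?thesis
        using m self_le_power[of q "CARD('d)"] by (simp add: T_def card_tiling Suc_le_eq)
    qed simp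
    show "indep_events (\<lambda>t. shift t -` cylinder \<xi> ?\<Lambda>) (T q)" for q
      unfolding T_def by (rule indep_events_tiles[OF m])
    show "prob (shift t -` cylinder \<xi> ?\<Lambda>) = prob (cylinder \<xi> ?\<Lambda>)" for t
      by (intro prob_shift cylinder_measurable) simp
  qed (use m in \<open>simp add: T_def\<close>)
  then show ?thesis
  proof eventually_elim
    case (elim \<omega>)
    from filterlim_compose[OF elim filterlim_div_at_top[OF m(1)]] show ?case
      by (simp add: T indicator_def)
  qed
qed

text \<open>A function of finitely many two-valued colours is a linear combination of indicators of patterns.\<close>

lemma pattern_expansion:
  fixes h :: "'d config \<Rightarrow> real"
  assumes "finite \<Lambda>" and local: "\<And>\<omega>. h (restrict \<omega> \<Lambda>) = h \<omega>"
  shows "h \<omega> = (\<Sum>\<xi>\<in>\<Lambda> \<rightarrow>\<^sub>E UNIV. h \<xi> * indicator (cylinder \<xi> \<Lambda>) \<omega>)"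
proof -
  have "\<omega> \<in> cylinder \<xi> \<Lambda> \<longleftrightarrow> \<xi> = restrict \<omega> \<Lambda>" if "\<xi> \<in> \<Lambda> \<rightarrow>\<^sub>E UNIV" for \<xi>
    using that restrict_eq_iff[of \<omega> \<Lambda> \<xi>] by (auto simp: cylinder_def PiE_restrict)
  then have "(\<Sum>\<xi>\<in>\<Lambda> \<rightarrow>\<^sub>E UNIV. h \<xi> * indicator (cylinder \<xi> \<Lambda>) \<omega>)
      = (\<Sum>\<xi>\<in>\<Lambda> \<rightarrow>\<^sub>E UNIV. if \<xi> = restrict \<omega> \<Lambda> then h \<xi> else 0)"
    by (intro sum.cong) (auto simp: indicator_def)
  also have "\<dots> = h (restrict \<omega> \<Lambda>)"
    using assms(1) by (subst sum.delta) (auto simp: finite_PiE)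
  finally show ?thesis
    by (simp add: local)
qed

lemma tile_averages_converge:
  fixes h :: "'d config \<Rightarrow> real"
  assumes m: "1 \<le> m" "2 * r < m" and local: "\<And>\<omega>. h (restrict \<omega> (inner_part r (cube m))) = h \<omega>"
  shows "AE \<omega> in P. (\<lambda>n. (\<Sum>t\<in>tiling m n. h (shift t \<omega>)) / real (card (tiling m n :: 'd site set)))
    \<longlonglongrightarrow> expectation h"
proof -
  let ?\<Lambda> = "inner_part r (cube m) :: 'd site set"
  let ?\<Xi> = "?\<Lambda> \<rightarrow>\<^sub>E UNIV :: 'd config set"
  have fin: "finite ?\<Xi>"
    by (simp add: finite_PiE)
  have h: "h = (\<lambda>\<omega>. \<Sum>\<xi>\<in>?\<Xi>. h \<xi> * indicator (cylinder \<xi> ?\<Lambda>) \<omega>)"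
    by (rule ext, rule pattern_expansion[where h = h, OF _ local]) simp
  have exp: "expectation h = (\<Sum>\<xi>\<in>?\<Xi>. h \<xi> * prob (cylinder \<xi> ?\<Lambda>))"
    by (subst h, subst Bochner_Integration.integral_sum)
      (auto simp: cylinder_measurable emeasure_eq_measure intro!: integrable_mult_right integrable_real_indicator)
  have "AE \<omega> in P. \<forall>\<xi>\<in>?\<Xi>. (\<lambda>n. (\<Sum>t\<in>tiling m n. indicator (cylinder \<xi> ?\<Lambda>) (shift t \<omega>))
      / real (card (tiling m n :: 'd site set))) \<longlonglongrightarrow> prob (cylinder \<xi> ?\<Lambda>)"
    using fin pattern_frequencies_converge[OF m] by (intro AE_finite_allI) auto
  then show ?thesis
  proof eventually_elim
    case (elim \<omega>)
    have "(\<lambda>n. \<Sum>\<xi>\<in>?\<Xi>. h \<xi> * ((\<Sum>t\<in>tiling m n. indicator (cylinder \<xi> ?\<Lambda>) (shift t \<omega>))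
        / real (card (tiling m n :: 'd site set)))) \<longlonglongrightarrow> expectation h"
      unfolding exp by (intro tendsto_sum tendsto_mult tendsto_const) (use elim in blast)
    moreover have "(\<Sum>\<xi>\<in>?\<Xi>. h \<xi> * ((\<Sum>t\<in>tiling m n. indicator (cylinder \<xi> ?\<Lambda>) (shift t \<omega>))
        / real (card (tiling m n :: 'd site set)))) =
        (\<Sum>t\<in>tiling m n. h (shift t \<omega>)) / real (card (tiling m n :: 'd site set))" for n
    proof -
      have "(\<Sum>t\<in>tiling m n. h (shift t \<omega>))
          = (\<Sum>t\<in>tiling m n. \<Sum>\<xi>\<in>?\<Xi>. h \<xi> * indicator (cylinder \<xi> ?\<Lambda>) (shift t \<omega>))"
        by (rule sum.cong[OF refl], rule pattern_expansion[where h = h, OF _ local]) simp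
      also have "\<dots> = (\<Sum>\<xi>\<in>?\<Xi>. h \<xi> * (\<Sum>t\<in>tiling m n. indicator (cylinder \<xi> ?\<Lambda>) (shift t \<omega>)))"
        by (subst sum.swap) (simp add: sum_distrib_left)
      finally show ?thesis
        by (simp only: sum_divide_distrib[symmetric] times_divide_eq_right)
    qed
    ultimately show ?case
      by simp
  qed
qed

end

section \<open>Comparison of a large cube with its tiles\<close>

definition tile_average :: "nat \<Rightarrow> nat \<Rightarrow> nat \<Rightarrow> 'd::finite config \<Rightarrow> real \<Rightarrow> real" where
  "tile_average r m n \<omega> E = (\<Sum>t\<in>tiling m n. cluster_count (inner_part r (cube m)) (shift t \<omega>) E)
    / real (card (tiling m n :: 'd site set))"

text \<open>The sites of the cube outside of all shrunken tiles are treated as one more part. It contributes at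
  most its number of sites twice: once for its clusters and once for its inner boundary.\<close>

lemma cluster_count_cube_tiles:
  fixes \<omega> :: "'d::finite config" and n :: nat
  assumes m: "1 \<le> m" "2 * r < m"
  defines "d \<equiv> CARD('d)" and "q \<equiv> n div m" and "s \<equiv> m - 2 * r"
  shows "\<bar>cluster_count (cube n) \<omega> E
      - (\<Sum>t\<in>tiling m n. cluster_count (inner_part r (cube m)) (shift t \<omega>) E)\<bar>
    \<le> 2 * (real n ^ d - (real q * real s) ^ d) + real q ^ d * (2 * real d * real s ^ (d - 1))"
proof -
  let ?T = "tiling m n :: 'd site set"
  let ?\<Lambda> = "inner_part r (cube m) :: 'd site set"
  define U where "U = (\<Union>t\<in>?T. translate ?\<Lambda> t)"
  define R where "R = cube n - U"
  \<comment> \<open>The left-over part has the index \<open>None\<close>.\<close>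
  define L where "L = case_option R (translate ?\<Lambda>)"
  have s: "nat (int m - int r - int r) = s" "int m - int r - int r = int s"
    using m by (auto simp: s_def)
  have card_\<Lambda>: "card ?\<Lambda> = s ^ d"
    by (simp add: inner_part_cube card_lattice_box s d_def)
  have "U \<subseteq> cube n"
    unfolding U_def using tile_subset_cube[of _ m n r] by blast
  have "card U = (\<Sum>t\<in>?T. card (translate ?\<Lambda> t))"
    unfolding U_def using m tiles_disjoint[OF m(1), of r n]
    by (intro card_UN_disjoint) (auto simp: disjoint_family_on_def)
  then have "card U = q ^ d * s ^ d"
    using m by (simp add: card_\<Lambda> card_tiling d_def q_def)
  moreover have "card U + card R = n ^ d"
    using \<open>U \<subseteq> cube n\<close> card_mono[OF finite_cube \<open>U \<subseteq> cube n\<close>]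
    by (simp add: R_def card_Diff_subset finite_subset[OF _ finite_cube] card_cube d_def)
  ultimately have card_R: "real (card R) = real n ^ d - (real q * real s) ^ d"
    by (metis add_diff_cancel_left' of_nat_add of_nat_mult of_nat_power power_mult_distrib)
  have fin_R: "finite R"
    by (simp add: R_def)
  have "\<bar>cluster_count (\<Union>i\<in>insert None (Some ` ?T). L i) \<omega> E
        - (\<Sum>i\<in>insert None (Some ` ?T). cluster_count (L i) \<omega> E)\<bar>
      \<le> (\<Sum>i\<in>insert None (Some ` ?T). real (card (inner_boundary (L i))))"
  proof (rule cluster_count_almost_additive)
    show "disjoint_family_on L (insert None (Some ` ?T))"
      using tiles_disjoint[OF m(1), of r n]
      by (auto simp: disjoint_family_on_def L_def R_def U_def)
  qed (use m fin_R in \<open>auto simp: L_def\<close>)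
  moreover have "(\<Union>i\<in>insert None (Some ` ?T). L i) = cube n"
    using \<open>U \<subseteq> cube n\<close> by (auto simp: L_def R_def U_def)
  moreover have "(\<Sum>i\<in>insert None (Some ` ?T). cluster_count (L i) \<omega> E)
      = cluster_count R \<omega> E + (\<Sum>t\<in>?T. cluster_count ?\<Lambda> (shift t \<omega>) E)"
    using m by (subst sum.insert) (auto simp: L_def sum.reindex cluster_count_translate)
  moreover have "(\<Sum>i\<in>insert None (Some ` ?T). real (card (inner_boundary (L i))))
      = real (card (inner_boundary R)) + (\<Sum>t\<in>?T. real (card (inner_boundary ?\<Lambda>)))"
    using m by (subst sum.insert) (auto simp: L_def sum.reindex inner_boundary_translate)
  ultimately have "\<bar>cluster_count (cube n) \<omega> E
        - (cluster_count R \<omega> E + (\<Sum>t\<in>?T. cluster_count ?\<Lambda> (shift t \<omega>) E))\<bar>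
      \<le> real (card (inner_boundary R)) + real (card ?T) * real (card (inner_boundary ?\<Lambda>))"
    by simp
  moreover have "real (card ?T) = real q ^ d"
    using m by (simp add: card_tiling q_def d_def)
  moreover have "real (card (inner_boundary ?\<Lambda>)) \<le> 2 * real d * real s ^ (d - 1)"
    unfolding inner_part_cube d_def by (rule card_inner_boundary_lattice_box) (rule s)
  then have "real q ^ d * real (card (inner_boundary ?\<Lambda>)) \<le> real q ^ d * (2 * real d * real s ^ (d - 1))"
    by (rule mult_left_mono) simp
  moreover have "real (card (inner_boundary R)) \<le> real (card R)"
    using inner_boundary_subset[of R] fin_R by (simp add: card_mono)
  moreover have "0 \<le> cluster_count R \<omega> E" "cluster_count R \<omega> E \<le> real (card R)"
    using cluster_count_nonneg cluster_count_le_card[OF fin_R] by auto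
  ultimately show ?thesis
    using card_R by (smt (verit))
qed

text \<open>The passage from counts to densities. Here \<open>N\<close>, \<open>Q\<close> and \<open>R\<close> are the numbers of sites in
  the cube, in the tiles and in the shrunken tiles, and \<open>B\<close> is the boundary contribution of the tiles.\<close>

lemma abs_ratio_diff_le:
  fixes X Y N Q R B a b c :: real
  assumes "\<bar>X - Y\<bar> \<le> 2 * (N - R) + B" "0 \<le> Y" "Y \<le> Q" "0 < Q" "Q \<le> N"
    and a: "N - Q \<le> a * N" and b: "Q - R \<le> b * N" and c: "B \<le> c * N"
  shows "\<bar>X / N - Y / Q\<bar> \<le> 3 * a + 2 * b + c"
proof -
  have N: "0 < N"
    using assms by linarith
  have "X / N - Y / Q = (X - Y) / N - (Y / Q) * ((N - Q) / N)"
    using N assms(4) by (simp add: field_simps)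
  then have "\<bar>X / N - Y / Q\<bar> \<le> \<bar>(X - Y) / N\<bar> + \<bar>(Y / Q) * ((N - Q) / N)\<bar>"
    by linarith
  moreover have "\<bar>(X - Y) / N\<bar> \<le> 2 * (a + b) + c"
  proof -
    have "\<bar>X - Y\<bar> \<le> (2 * (a + b) + c) * N"
      using assms(1) a b c by (simp add: algebra_simps)
    then show ?thesis
      using N by (simp add: abs_divide pos_divide_le_eq)
  qed
  moreover have "\<bar>(Y / Q) * ((N - Q) / N)\<bar> \<le> 1 * a"
    unfolding abs_mult
  proof (rule mult_mono)
    show "\<bar>Y / Q\<bar> \<le> 1"
      using assms by simp
    show "\<bar>(N - Q) / N\<bar> \<le> a"
      using N assms(5) a by (simp add: pos_divide_le_eq)
  qed auto
  ultimately show ?thesis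
    by (simp add: algebra_simps)
qed

lemma cluster_density_tile_average:
  fixes \<omega> :: "'d::finite config"
  assumes m: "2 * r < m" and n: "m \<le> n"
  defines "d \<equiv> CARD('d)"
  shows "\<bar>cluster_count (cube n) \<omega> E / real n ^ d - tile_average r m n \<omega> E / real m ^ d\<bar>
    \<le> 3 * (real d * real m / real n) + (4 * real d * real r + 2 * real d) / real m"
proof -
  define q where "q = n div m"
  define s where "s = m - 2 * r"
  have m1: "1 \<le> m" and pos: "0 < real m" "0 < real n"
    using m n by auto
  have d: "0 < d"
    by (simp add: d_def)
  have pow: "x ^ d = x * x ^ (d - 1)" for x :: real
    using d by (cases d) auto
  define N where "N = real n ^ d"
  define Q where "Q = (real q * real m) ^ d"
  define Y where "Y = (\<Sum>t\<in>tiling m n. cluster_count (inner_part r (cube m)) (shift t \<omega>) E)"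
  have "0 < q"
    using m1 n by (simp add: q_def div_greater_zero_iff)
  have qm: "real q * real m \<le> real n"
    by (simp add: q_def flip: of_nat_mult)
  have qm': "real n - real q * real m \<le> real m"
  proof -
    have "n = q * m + n mod m"
      by (simp add: q_def)
    then have "real n = real q * real m + real (n mod m)"
      by (metis of_nat_add of_nat_mult)
    moreover have "n mod m < m"
      using m1 by simp
    ultimately show ?thesis
      by simp
  qed
  have sm: "real s \<le> real m" "real m - real s = 2 * real r"
    using m by (auto simp: s_def of_nat_diff)
  have QN: "0 < Q" "Q \<le> N"
    using \<open>0 < q\<close> pos qm by (auto simp: Q_def N_def intro: power_mono)
  have "card (inner_part r (cube m) :: 'd site set) = s ^ d"
  proof -
    have "nat (int m - int r - int r) = s"
      using m unfolding s_def by linarith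
    then show ?thesis
      by (simp add: inner_part_cube card_lattice_box d_def)
  qed
  have "\<bar>cluster_count (cube n) \<omega> E / N - Y / Q\<bar>
      \<le> 3 * (real d * real m / real n) + 2 * (2 * real d * real r / real m) + 2 * real d / real m"
  proof (rule abs_ratio_diff_le)
    show "\<bar>cluster_count (cube n) \<omega> E - Y\<bar>
        \<le> 2 * (N - (real q * real s) ^ d) + real q ^ d * (2 * real d * real s ^ (d - 1))"
      using cluster_count_cube_tiles[OF m1 m, of n \<omega> E] by (simp add: Y_def N_def q_def s_def d_def)
    show "0 \<le> Y"
      unfolding Y_def by (intro sum_nonneg cluster_count_nonneg)
    have "Y \<le> (\<Sum>t\<in>(tiling m n :: 'd site set). real s ^ d)"
      unfolding Y_def
    proof (rule sum_mono)
      fix t :: "'d site"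
      show "cluster_count (inner_part r (cube m)) (shift t \<omega>) E \<le> real s ^ d"
        using cluster_count_le_card[of "inner_part r (cube m)" "shift t \<omega>" E] \<open>card _ = _\<close> by simp
    qed
    also have "\<dots> = (real q * real s) ^ d"
      using m1 by (simp add: card_tiling q_def d_def power_mult_distrib)
    also have "\<dots> \<le> Q"
      unfolding Q_def using sm by (intro power_mono mult_left_mono) auto
    finally show "Y \<le> Q" .
    have "N - Q \<le> real d * (real n - real q * real m) * real n ^ (d - 1)"
      unfolding N_def Q_def using qm by (intro power_diff_le) auto
    also have "\<dots> \<le> real d * real m * real n ^ (d - 1)"
      using qm' by (intro mult_right_mono mult_left_mono) auto
    also have "\<dots> = real d * real m / real n * N"
      using pos by (simp add: N_def pow[of "real n"])
    finally show "N - Q \<le> real d * real m / real n * N" .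
    have "Q - (real q * real s) ^ d = real q ^ d * (real m ^ d - real s ^ d)"
      by (simp add: Q_def power_mult_distrib algebra_simps)
    also have "\<dots> \<le> real q ^ d * (real d * (real m - real s) * real m ^ (d - 1))"
      using sm by (intro mult_left_mono power_diff_le) auto
    also have "\<dots> = 2 * real d * real r / real m * Q"
      using pos by (simp add: Q_def sm power_mult_distrib pow[of "real m"])
    also have "\<dots> \<le> 2 * real d * real r / real m * N"
      using QN by (intro mult_left_mono) auto
    finally show "Q - (real q * real s) ^ d \<le> 2 * real d * real r / real m * N" .
    have "real q ^ d * (2 * real d * real s ^ (d - 1)) \<le> real q ^ d * (2 * real d * real m ^ (d - 1))"
      using sm by (intro mult_left_mono power_mono) auto
    also have "\<dots> = 2 * real d / real m * Q"
      using pos by (simp add: Q_def power_mult_distrib pow[of "real m"])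
    also have "\<dots> \<le> 2 * real d / real m * N"
      using QN by (intro mult_left_mono) auto
    finally show "real q ^ d * (2 * real d * real s ^ (d - 1)) \<le> 2 * real d / real m * N" .
  qed (use QN in auto)
  also have "Y / Q = tile_average r m n \<omega> E / real m ^ d"
    using m1 by (simp add: tile_average_def Y_def Q_def card_tiling q_def d_def power_mult_distrib)
  finally show ?thesis
    using pos by (simp add: N_def add_divide_distrib)
qed

section \<open>Existence of the limit and the error estimate\<close>

lemma cluster_count_floor_cong:
  assumes "finite \<Lambda>" "\<lfloor>E\<rfloor> = \<lfloor>E'\<rfloor>"
  shows "cluster_count \<Lambda> \<omega> E = cluster_count \<Lambda> \<omega> E'"
  using assms by (metis cluster_count_step)

text \<open>The bounds \<open>2 * d \<le> 2 ^ (d + 1)\<close>, \<open>m \<le> m ^ d\<close> and \<open>r \<le> r ^ d\<close> absorb all factors that are linear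
  in the dimension and in the lengths.\<close>

lemma error_bound_arith:
  assumes "r < m" "m < n" "0 < d"
  shows "3 * (real d * real m / real n) + 2 * ((4 * real d * real r + 2 * real d) / real m)
    \<le> 2 ^ (d + 1) * ((8 * real m ^ d + 2) / (real n - real m) + (10 * real r ^ d + 6) / (real m - real r))"
proof -
  have pow: "real x \<le> real x ^ d" for x
    using assms(3) self_le_power[of "real x" d] by (cases "x = 0") auto
  have d: "2 * real d \<le> 2 ^ (d + 1)"
    using of_nat_less_two_power[of d, where 'a = real] by simp
  have "3 * (real d * real m / real n) = (2 * real d) * (3 / 2 * real m) / real n"
    by simp
  also have "\<dots> \<le> 2 ^ (d + 1) * (8 * real m ^ d + 2) / (real n - real m)"
  proof (intro frac_le mult_mono d)
    show "3 / 2 * real m \<le> 8 * real m ^ d + 2"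
      using pow[of m] of_nat_0_le_iff[of m] by linarith
  qed (use assms in auto)
  finally have 1: "3 * (real d * real m / real n) \<le> 2 ^ (d + 1) * ((8 * real m ^ d + 2) / (real n - real m))"
    by simp
  have "2 * ((4 * real d * real r + 2 * real d) / real m) = (2 * real d) * (4 * real r + 2) / real m"
    by (simp add: field_simps)
  also have "\<dots> \<le> 2 ^ (d + 1) * (10 * real r ^ d + 6) / (real m - real r)"
  proof (intro frac_le mult_mono d)
    show "4 * real r + 2 \<le> 10 * real r ^ d + 6"
      using pow[of r] of_nat_0_le_iff[of r] by linarith
  qed (use assms in auto)
  finally have 2: "2 * ((4 * real d * real r + 2 * real d) / real m)
      \<le> 2 ^ (d + 1) * ((10 * real r ^ d + 6) / (real m - real r))"
    by simp
  show ?thesis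
    using 1 2 by (simp add: distrib_left)
qed

lemma cluster_count_measurable: "finite \<Lambda> \<Longrightarrow> (\<lambda>\<eta>. cluster_count \<Lambda> \<eta> E) \<in> borel_measurable (config_space \<Lambda>)"
  unfolding config_space_def by (subst count_space_PiM_finite) auto

context finite_range_law
begin

definition block_density :: "nat \<Rightarrow> real \<Rightarrow> real" where
  "block_density m E = expectation (\<lambda>\<omega>. cluster_count (inner_part r (cube m)) \<omega> E) / real m ^ CARD('d)"

text \<open>Countably many levels \<open>k\<close> are enough, as the counting functions only jump at integers; hence almost
  all configurations are typical.\<close>

definition typical :: "'d config \<Rightarrow> bool" where
  "typical \<omega> \<longleftrightarrow> (\<forall>m k. 2 * r < m \<longrightarrow>
    (\<lambda>n. tile_average r m n \<omega> (real k)) \<longlonglongrightarrow> expectation (\<lambda>\<omega>. cluster_count (inner_part r (cube m)) \<omega> (real k)))"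

lemma AE_typical: "AE \<omega> in P. typical \<omega>"
proof -
  have "AE \<omega> in P. 2 * r < m \<longrightarrow> (\<lambda>n. tile_average r m n \<omega> (real k))
      \<longlonglongrightarrow> expectation (\<lambda>\<omega>. cluster_count (inner_part r (cube m)) \<omega> (real k))" for m k
  proof (cases "2 * r < m")
    case True
    have "AE \<omega> in P. (\<lambda>n. tile_average r m n \<omega> (real k))
        \<longlonglongrightarrow> expectation (\<lambda>\<omega>. cluster_count (inner_part r (cube m)) \<omega> (real k))"
      unfolding tile_average_def
      using True by (intro tile_averages_converge) (simp, simp, simp only: cluster_count_restrict)
    then show ?thesis
      by eventually_elim simp
  qed simp
  then show ?thesis
    unfolding typical_def AE_all_countable by blast
qed

lemma block_density_bounds: "0 \<le> block_density m E" "block_density m E \<le> 1"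
proof -
  let ?\<Lambda> = "inner_part r (cube m) :: 'd site set"
  have "card ?\<Lambda> \<le> card (cube m :: 'd site set)"
    by (intro card_mono inner_part_subset) simp
  then have le: "real (card ?\<Lambda>) \<le> real m ^ CARD('d)"
    by (simp add: card_cube flip: of_nat_power)
  have "\<bar>expectation (\<lambda>\<omega>. cluster_count ?\<Lambda> \<omega> E)\<bar> \<le> real (card ?\<Lambda>)"
    by (intro abs_integral_le abs_cluster_count_le_card) simp
  then have "expectation (\<lambda>\<omega>. cluster_count ?\<Lambda> \<omega> E) \<le> real m ^ CARD('d)"
    using le by linarith
  then show "block_density m E \<le> 1"
    unfolding block_density_def by (cases "m = 0") (auto simp: divide_le_eq_1)
  show "0 \<le> block_density m E"
    unfolding block_density_def by (intro divide_nonneg_nonneg Bochner_Integration.integral_nonneg) (auto intro: cluster_count_nonneg)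
qed

lemma block_density_floor_cong: "\<lfloor>E\<rfloor> = \<lfloor>E'\<rfloor> \<Longrightarrow> block_density m E = block_density m E'"
  unfolding block_density_def using cluster_count_floor_cong[of "inner_part r (cube m) :: 'd site set" E E'] by simp

text \<open>At every level the counts agree with those at one of the levels \<open>0, \<dots>, card \<Lambda>\<close>, so convergence at
  these finitely many levels is uniform convergence.\<close>

lemma tile_average_uniform:
  assumes "typical \<omega>" "2 * r < m" "0 < e"
  shows "eventually (\<lambda>n. \<forall>E. \<bar>tile_average r m n \<omega> E
    - expectation (\<lambda>\<omega>. cluster_count (inner_part r (cube m)) \<omega> E)\<bar> < e) sequentially"
proof -
  let ?\<Lambda> = "inner_part r (cube m) :: 'd site set"
  let ?k = "\<lambda>E. real (min (card ?\<Lambda>) (nat \<lfloor>E\<rfloor>))"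
  have "eventually (\<lambda>n. dist (tile_average r m n \<omega> (real k))
      (expectation (\<lambda>\<omega>. cluster_count ?\<Lambda> \<omega> (real k))) < e) sequentially" for k
    using assms unfolding typical_def by (intro tendstoD) auto
  then have "eventually (\<lambda>n. \<forall>k\<in>{..card ?\<Lambda>}. dist (tile_average r m n \<omega> (real k))
      (expectation (\<lambda>\<omega>. cluster_count ?\<Lambda> \<omega> (real k))) < e) sequentially"
    by (intro eventually_ball_finite) auto
  then show ?thesis
  proof eventually_elim
    case (elim n)
    show ?case
    proof
      fix E :: real
      have step: "cluster_count ?\<Lambda> \<eta> E = cluster_count ?\<Lambda> \<eta> (?k E)" for \<eta>
        by (rule cluster_count_step) simp
      have "tile_average r m n \<omega> E = tile_average r m n \<omega> (?k E)"
        unfolding tile_average_def using step by simp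
      moreover have "expectation (\<lambda>\<omega>. cluster_count ?\<Lambda> \<omega> E) = expectation (\<lambda>\<omega>. cluster_count ?\<Lambda> \<omega> (?k E))"
        using step by simp
      ultimately show "\<bar>tile_average r m n \<omega> E - expectation (\<lambda>\<omega>. cluster_count ?\<Lambda> \<omega> E)\<bar> < e"
        using elim[rule_format, of "min (card ?\<Lambda>) (nat \<lfloor>E\<rfloor>)"] by (simp only: dist_real_def) simp
    qed
  qed
qed

definition block_error :: "nat \<Rightarrow> real" where
  "block_error m = (4 * real CARD('d) * real r + 2 * real CARD('d)) / real m"

lemma block_error_tendsto_0: "block_error \<longlonglongrightarrow> 0"
  unfolding block_error_def[abs_def]
  by (intro real_tendsto_divide_at_top[OF tendsto_const] filterlim_real_sequentially)

lemma density_near_block_density: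
  assumes "typical \<omega>" and m: "2 * r < m" and e: "0 < e"
  shows "eventually (\<lambda>n. \<forall>E. \<bar>cluster_count (cube n) \<omega> E / real n ^ CARD('d) - block_density m E\<bar>
    \<le> block_error m + e) sequentially"
proof -
  have "(\<lambda>n. 3 * real CARD('d) * real m / real n) \<longlonglongrightarrow> 0"
    by (intro real_tendsto_divide_at_top[OF tendsto_const] filterlim_real_sequentially)
  then have "eventually (\<lambda>n. 3 * real CARD('d) * real m / real n < e / 2) sequentially"
    using e by (intro order_tendstoD) auto
  moreover have "eventually (\<lambda>n. \<forall>E. \<bar>tile_average r m n \<omega> E
      - expectation (\<lambda>\<omega>. cluster_count (inner_part r (cube m)) \<omega> E)\<bar> < e / 2) sequentially"
    by (rule tile_average_uniform[OF assms(1) m half_gt_zero[OF e]])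
  moreover have "eventually (\<lambda>n. m \<le> n) sequentially"
    by (rule eventually_ge_at_top)
  ultimately show ?thesis
  proof eventually_elim
    case (elim n)
    show ?case
    proof
      fix E :: real
      let ?X = "expectation (\<lambda>\<omega>. cluster_count (inner_part r (cube m)) \<omega> E)"
      have "1 \<le> real m ^ CARD('d)"
        using m by (intro one_le_power) simp
      have "\<bar>tile_average r m n \<omega> E / real m ^ CARD('d) - block_density m E\<bar>
          = \<bar>tile_average r m n \<omega> E - ?X\<bar> / real m ^ CARD('d)"
        by (simp add: block_density_def diff_divide_distrib[symmetric])
      also have "\<dots> \<le> \<bar>tile_average r m n \<omega> E - ?X\<bar> / 1"
        using m \<open>1 \<le> _\<close> by (intro divide_left_mono) auto
      also have "\<dots> < e / 2"
        using elim(2) by simp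
      finally show "\<bar>cluster_count (cube n) \<omega> E / real n ^ CARD('d) - block_density m E\<bar> \<le> block_error m + e"
        using cluster_density_tile_average[OF m elim(3), of \<omega> E] elim(1) unfolding block_error_def
        by linarith
    qed
  qed
qed

lemma ex_typical: "\<exists>\<omega>. typical \<omega>"
proof (rule ccontr)
  assume "\<not> (\<exists>\<omega>. typical \<omega>)"
  then have "AE \<omega> in P. False"
    using AE_typical by simp
  then show False
    by simp
qed

text \<open>Both block densities are close to the cluster densities of one typical configuration in large
  cubes.\<close>

lemma block_density_diff_le:
  assumes "2 * r < m" "2 * r < m'"
  shows "\<bar>block_density m E - block_density m' E\<bar> \<le> block_error m + block_error m'"
proof (rule field_le_epsilon)
  fix e :: real
  assume "0 < e"
  obtain \<omega> where \<omega>: "typical \<omega>"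
    using ex_typical by blast
  have "eventually (\<lambda>n. \<bar>block_density m E - block_density m' E\<bar> \<le> block_error m + block_error m' + e) sequentially"
    using density_near_block_density[OF \<omega> assms(1) half_gt_zero[OF \<open>0 < e\<close>]]
      density_near_block_density[OF \<omega> assms(2) half_gt_zero[OF \<open>0 < e\<close>]]
  proof eventually_elim
    case (elim n)
    show ?case
      using elim(1)[rule_format, of E] elim(2)[rule_format, of E] by linarith
  qed
  then show "\<bar>block_density m E - block_density m' E\<bar> \<le> block_error m + block_error m' + e"
    by simp
qed

definition cluster_density :: "real \<Rightarrow> real" where
  "cluster_density E = lim (\<lambda>m. block_density m E)"

lemma block_density_tendsto: "(\<lambda>m. block_density m E) \<longlonglongrightarrow> cluster_density E"
proof -
  have "Cauchy (\<lambda>m. block_density m E)"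
  proof (rule metric_CauchyI)
    fix e :: real
    assume "0 < e"
    then have "eventually (\<lambda>m. block_error m < e / 2) sequentially"
      using block_error_tendsto_0 by (intro order_tendstoD) auto
    then have "eventually (\<lambda>m. block_error m < e / 2 \<and> 2 * r < m) sequentially"
      using eventually_gt_at_top by (rule eventually_conj)
    then obtain M where M: "\<And>m. M \<le> m \<Longrightarrow> block_error m < e / 2 \<and> 2 * r < m"
      unfolding eventually_sequentially by blast
    have "dist (block_density m E) (block_density m' E) < e" if "M \<le> m" "M \<le> m'" for m m'
      using M[OF that(1)] M[OF that(2)] block_density_diff_le[of m m' E] by (simp add: dist_real_def)
    then show "\<exists>M. \<forall>m\<ge>M. \<forall>m'\<ge>M. dist (block_density m E) (block_density m' E) < e"
      by blast
  qed
  then show ?thesis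
    by (simp add: cluster_density_def Cauchy_convergent convergent_LIMSEQ_iff[symmetric])
qed

lemma block_density_near_cluster_density:
  assumes "2 * r < m"
  shows "\<bar>block_density m E - cluster_density E\<bar> \<le> block_error m"
proof (rule LIMSEQ_le)
  show "(\<lambda>m'. \<bar>block_density m E - block_density m' E\<bar>) \<longlonglongrightarrow> \<bar>block_density m E - cluster_density E\<bar>"
    by (intro tendsto_intros block_density_tendsto)
  show "(\<lambda>m'. block_error m + block_error m') \<longlonglongrightarrow> block_error m"
    using tendsto_add[OF tendsto_const block_error_tendsto_0, of "block_error m"] by simp
  show "\<exists>N. \<forall>m'\<ge>N. \<bar>block_density m E - block_density m' E\<bar> \<le> block_error m + block_error m'"
    using block_density_diff_le[OF assms] by (intro exI[of _ "Suc (2 * r)"]) auto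
qed

lemma cluster_density_bounds: "0 \<le> cluster_density E" "cluster_density E \<le> 1"
  using LIMSEQ_le_const[OF block_density_tendsto] LIMSEQ_le_const2[OF block_density_tendsto]
    block_density_bounds by blast+

lemma cluster_density_rc_bounded: "cluster_density \<in> rc_bounded"
proof (rule rc_bounded_if_step)
  show "cluster_density E = cluster_density E'" if "\<lfloor>E\<rfloor> = \<lfloor>E'\<rfloor>" for E E'
    unfolding cluster_density_def using block_density_floor_cong[OF that] by simp
  show "\<bar>cluster_density E\<bar> \<le> 1" for E
    using cluster_density_bounds[of E] by simp
qed

lemma density_tendsto_uniformly:
  assumes "typical \<omega>"
  shows "(\<lambda>n. sup_norm (\<lambda>E. cluster_count (cube n) \<omega> E / real n ^ CARD('d) - cluster_density E)) \<longlonglongrightarrow> 0"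
proof (rule tendstoI)
  fix e :: real
  assume e: "0 < e"
  have "eventually (\<lambda>m. block_error m < e / 4) sequentially"
    using block_error_tendsto_0 e by (intro order_tendstoD) auto
  then have "eventually (\<lambda>m. block_error m < e / 4 \<and> 2 * r < m) sequentially"
    using eventually_gt_at_top by (rule eventually_conj)
  then obtain m where m: "block_error m < e / 4" "2 * r < m"
    unfolding eventually_sequentially by blast
  have "0 < e / 4"
    using e by simp
  from density_near_block_density[OF assms m(2) this]
  show "eventually (\<lambda>n. dist (sup_norm (\<lambda>E. cluster_count (cube n) \<omega> E / real n ^ CARD('d) - cluster_density E)) 0 < e)
      sequentially"
  proof eventually_elim
    case (elim n)
    have bound: "\<bar>cluster_count (cube n) \<omega> E / real n ^ CARD('d) - cluster_density E\<bar> \<le> 3 * e / 4" for E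
      using elim[rule_format, of E] block_density_near_cluster_density[OF m(2), of E] m(1) by linarith
    then have "sup_norm (\<lambda>E. cluster_count (cube n) \<omega> E / real n ^ CARD('d) - cluster_density E) \<le> 3 * e / 4"
      by (rule sup_norm_le)
    moreover have "0 \<le> sup_norm (\<lambda>E. cluster_count (cube n) \<omega> E / real n ^ CARD('d) - cluster_density E)"
      using bound by (rule sup_norm_nonneg)
    ultimately show ?case
      using e by (simp add: dist_real_def)
  qed
qed

lemma pairing_marginal:
  assumes "finite \<Lambda>"
  shows "pairing (cluster_count \<Lambda>) (marginal P \<Lambda>) E = expectation (\<lambda>\<omega>. cluster_count \<Lambda> \<omega> E)"
  unfolding pairing_def marginal_def
  by (subst integral_distr[OF measurable_restriction cluster_count_measurable[OF assms]])
    (simp add: cluster_count_restrict)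

lemma prob_space_marginal: "prob_space (marginal P \<Lambda>)"
  unfolding marginal_def by (rule prob_space_distr[OF measurable_restriction])

end

lemma measurable_uniform_count_measure:
  "g \<in> A \<rightarrow> space N \<Longrightarrow> g \<in> uniform_count_measure A \<rightarrow>\<^sub>M N"
  by (simp add: measurable_def space_uniform_count_measure sets_uniform_count_measure)

lemma restrict_in_config_space: "(\<lambda>t. restrict (\<omega> t) \<Lambda>) \<in> A \<rightarrow> space (config_space \<Lambda>)"
  by (auto simp: config_space_def space_PiM)

lemma prob_space_empirical:
  assumes "1 \<le> m" "m \<le> n"
  shows "prob_space (empirical m n r \<omega>)"
  unfolding empirical_def
  using assms
  by (intro prob_space.prob_space_distr prob_space_uniform_count_measure measurable_uniform_count_measure
      restrict_in_config_space finite_tiling tiling_nonempty)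

lemma pairing_empirical:
  assumes "1 \<le> m"
  shows "pairing (cluster_count (inner_part r (cube m))) (empirical m n r \<omega>) E = tile_average r m n \<omega> E"
proof -
  let ?\<Lambda> = "inner_part r (cube m) :: 'a site set"
  have "(\<lambda>t. restrict (shift t \<omega>) ?\<Lambda>) \<in> uniform_count_measure (tiling m n) \<rightarrow>\<^sub>M config_space ?\<Lambda>"
    by (intro measurable_uniform_count_measure restrict_in_config_space)
  then have "pairing (cluster_count ?\<Lambda>) (empirical m n r \<omega>) E =
      (\<integral>t. cluster_count ?\<Lambda> (restrict (shift t \<omega>) ?\<Lambda>) E \<partial>uniform_count_measure (tiling m n))"
    unfolding pairing_def empirical_def
    by (rule integral_distr) (simp add: cluster_count_measurable)
  also have "\<dots> = tile_average r m n \<omega> E"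
    using assms by (simp only: cluster_count_restrict integral_uniform_count_measure finite_tiling tile_average_def)
  finally show ?thesis .
qed

context finite_range_law
begin

lemma density_error_bound:
  assumes "r < m" "m < n"
  shows "sup_norm (\<lambda>E. cluster_count (cube n) \<omega> E / real n ^ CARD('d) - cluster_density E)
    \<le> 2 ^ (CARD('d) + 1) * ((8 * real m ^ CARD('d) + 2) / (real n - real m)
        + (10 * real r ^ CARD('d) + 6) / (real m - real r))
      + (SUP g\<in>admissible_class 3 2 2 1.
          sup_norm (\<lambda>E. pairing (g (inner_part r (cube m))) (empirical m n r \<omega>) E -
                        pairing (g (inner_part r (cube m))) (marginal P (inner_part r (cube m))) E)
          / real (card (cube m :: 'd site set)))" (is "_ \<le> ?err + ?sup")
proof -
  let ?\<Lambda> = "inner_part r (cube m) :: 'd site set"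
  define \<Delta> where "\<Delta> E = pairing (cluster_count ?\<Lambda>) (empirical m n r \<omega>) E
      - pairing (cluster_count ?\<Lambda>) (marginal P ?\<Lambda>) E" for E
  have m1: "1 \<le> m"
    using assms by simp
  have card_m: "real (card (cube m :: 'd site set)) = real m ^ CARD('d)"
    by (simp add: card_cube)
  have prob: "prob_space (empirical m n r \<omega>)"
    using assms by (intro prob_space_empirical) auto
  have \<Delta>: "\<bar>\<Delta> E\<bar> \<le> 2 * real (card ?\<Lambda>)" for E
  proof -
    have "\<bar>pairing (cluster_count ?\<Lambda>) (empirical m n r \<omega>) E\<bar> \<le> real (card ?\<Lambda>)"
      "\<bar>pairing (cluster_count ?\<Lambda>) (marginal P ?\<Lambda>) E\<bar> \<le> real (card ?\<Lambda>)"
      unfolding pairing_def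
      by (intro prob_space.abs_integral_le[OF prob] prob_space.abs_integral_le[OF prob_space_marginal]
          abs_cluster_count_le_card finite_inner_part_cube)+
    then show ?thesis
      unfolding \<Delta>_def by linarith
  qed
  have "sup_norm \<Delta> / real (card (cube m :: 'd site set)) \<le> ?sup"
    unfolding \<Delta>_def
  proof (rule cSUP_upper)
    show "(cluster_count :: 'd field) \<in> admissible_class 3 2 2 1"
      by (rule cluster_count_in_admissible_class) auto
  qed (rule bdd_above_pairing_difference[OF prob prob_space_marginal finite_inner_part_cube])
  then have sup: "sup_norm \<Delta> / real m ^ CARD('d) \<le> ?sup"
    by (simp only: card_m)
  show ?thesis
  proof (rule sup_norm_le)
    fix E
    show "\<bar>cluster_count (cube n) \<omega> E / real n ^ CARD('d) - cluster_density E\<bar> \<le> ?err + ?sup"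
    proof (cases "2 * r < m")
      case True
      have "tile_average r m n \<omega> E / real m ^ CARD('d) - block_density m E = \<Delta> E / real m ^ CARD('d)"
        using pairing_empirical[OF m1, of r n \<omega> E] pairing_marginal[of ?\<Lambda> E]
        by (simp add: \<Delta>_def block_density_def diff_divide_distrib)
      moreover have "\<bar>\<Delta> E / real m ^ CARD('d)\<bar> \<le> sup_norm \<Delta> / real m ^ CARD('d)"
        using le_sup_norm[of \<Delta>, OF \<Delta>] by (simp add: divide_right_mono)
      moreover have "3 * (real CARD('d) * real m / real n) + 2 * block_error m \<le> ?err"
        unfolding block_error_def using assms by (intro error_bound_arith) auto
      ultimately show ?thesis
        using cluster_density_tile_average[OF True, of n \<omega> E] assms(2) sup
          block_density_near_cluster_density[OF True, of E]
        unfolding block_error_def by linarith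
    next
      \<comment> \<open>Both densities lie in \<open>[0, 1]\<close>, and here the second error term alone exceeds \<open>1\<close>.\<close>
      case False
      have "real m - real r \<le> real r ^ CARD('d)"
      proof -
        have "real r \<le> real r ^ CARD('d)"
          using False assms(1) by (intro self_le_power) auto
        moreover have "real m \<le> 2 * real r"
          using False by linarith
        ultimately show ?thesis
          by linarith
      qed
      then have "1 \<le> (10 * real r ^ CARD('d) + 6) / (real m - real r)"
        using assms(1) by (simp add: pos_le_divide_eq)
      moreover have "0 \<le> (8 * real m ^ CARD('d) + 2) / (real n - real m)"
        using assms(2) by simp
      moreover have "1 \<le> (2::real) ^ (CARD('d) + 1)"
        by (rule one_le_power) simp
      ultimately have "1 * 1 \<le> ?err"
        by (intro mult_mono) auto
      moreover have "0 \<le> sup_norm \<Delta> / real m ^ CARD('d)"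
        using sup_norm_nonneg[of \<Delta>, OF \<Delta>] by simp
      moreover have "0 \<le> cluster_count (cube n) \<omega> E / real n ^ CARD('d)"
        "cluster_count (cube n) \<omega> E / real n ^ CARD('d) \<le> 1"
        using cluster_count_nonneg[of "cube n" \<omega> E] cluster_count_le_card[OF finite_cube, of n \<omega> E] assms
        by (auto simp: card_cube divide_le_eq_1)
      ultimately show ?thesis
        using sup cluster_density_bounds[of E] by linarith
    qed
  qed
qed

end

theorem corollary8p2:
  fixes P :: "'d::finite config measure"
    and \<mu> :: "'d site \<Rightarrow> bool measure"
    and r :: nat
  assumes "prob_space P"
    and "sets P = sets (config_space UNIV)"
    and "M1 P"
    and "M2 P \<mu>"
    and "M3 P \<mu> r"
  shows "\<exists>\<Omega>' fstar. \<Omega>' \<in> sets P \<and> emeasure P \<Omega>' = 1 \<and> fstar \<in> rc_bounded \<and>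
    (\<forall>\<omega>\<in>\<Omega>'.
       (\<lambda>n. sup_norm (\<lambda>E. cluster_count (cube n) \<omega> E / real (card (cube n :: 'd site set)) - fstar E))
         \<longlonglongrightarrow> 0) \<and>
    (\<forall>m n. r < m \<longrightarrow> m < n \<longrightarrow> (\<forall>\<omega>\<in>\<Omega>'.
       sup_norm (\<lambda>E. cluster_count (cube n) \<omega> E / real (card (cube n :: 'd site set)) - fstar E)
         \<le> 2 ^ (CARD('d) + 1) *
             ((8 * real m ^ CARD('d) + 2) / (real n - real m) +
              (10 * real r ^ CARD('d) + 6) / (real m - real r)) +
           (SUP g\<in>admissible_class 3 2 2 1.
              sup_norm (\<lambda>E. pairing (g (inner_part r (cube m))) (empirical m n r \<omega>) E -
                            pairing (g (inner_part r (cube m))) (marginal P (inner_part r (cube m))) E)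
              / real (card (cube m :: 'd site set)))))"
proof -
  interpret finite_range_law P \<mu> r
    using assms by (simp add: finite_range_law_def finite_range_law_axioms_def)
  obtain N where N: "{\<omega> \<in> space P. \<not> typical \<omega>} \<subseteq> N" "emeasure P N = 0" "N \<in> sets P"
    using AE_typical by (rule AE_E)
  have card_n: "real (card (cube n :: 'd site set)) = real n ^ CARD('d)" for n
    by (simp add: card_cube)
  have "emeasure P (space P - N) = 1"
    using emeasure_Diff_null_set[of N P "space P"] N emeasure_space_1 by (simp add: null_sets_def)
  moreover have "typical \<omega>" if "\<omega> \<in> space P - N" for \<omega>
    using that N(1) by blast
  ultimately show ?thesis
    using N(3) cluster_density_rc_bounded density_tendsto_uniformly density_error_bound
    by (intro exI[of _ "space P - N"] exI[of _ cluster_density])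
      (auto simp only: card_n intro: sets.compl_sets)
qed

end
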